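(* There exists a connected open set $X$ in the complex projective plane $\mathbb{C}\mathbb{P}^2$ such that $X$ admits a strongly plurisubharmonic function $\rho\colon X\to\mathbb{R}$, but every holomorphic function $f\colon X\to\mathbb{C}$ is constant.
   Context: Connected sets are understood to be nonempty. For a $\mathcal{C}^2$ function $\rho\colon X\to\mathbb{R}$ on a complex manifold $X$ of complex dimension $n$, its Levi form $\mathcal{L}_\rho$ is the quadratic Hermitian form on the tangent bundle $TX$ (identified in the standard way with the holomorphic tangent bundle $T^{1,0}X$) given in any local holomorphic coordinates $z=(z_1,\ldots,z_n)$ by $$\mathcal{L}_\rho(z;v)=\sum_{j,k=1}^n \frac{\partial^2\rho(z)}{\partial z_j\,\partial\bar z_k}\,v_j\overline{v}_k,\qquad v\in\mathbb{C}^n.$$ The function $\rho$ is strongly plurisubharmonic if $\mathcal{L}_\rho>0$, i.e. $\mathcal{L}_\rho(z;v)>0$ at every point and for every $v\neq 0$. (No exhaustion property of $\rho$ is required.) *)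

theory Defs
  imports "HOL-Analysis.Analysis"
begin

section \<open>Functions on open subsets of \<open>\<complex>\<^sup>n\<close>\<close>

text \<open>
  Holomorphy on an open set is complex Frechet differentiability at every point; the vector
  \<open>a\<close> collects the complex partial derivatives.
\<close>

definition holo_fun_on :: "(complex^'n) set \<Rightarrow> (complex^'n \<Rightarrow> complex) \<Rightarrow> bool" where
  "holo_fun_on S f \<longleftrightarrow>
     (\<forall>z\<in>S. \<exists>a. (f has_derivative (\<lambda>v. \<Sum>j\<in>UNIV. a $ j * v $ j)) (at z))"

definition holo_map_on :: "(complex^'n) set \<Rightarrow> (complex^'n \<Rightarrow> complex^'m) \<Rightarrow> bool" where
  "holo_map_on S f \<longleftrightarrow> (\<forall>k. holo_fun_on S (\<lambda>z. f z $ k))"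

definition C2_on :: "'a::real_normed_vector set \<Rightarrow> ('a \<Rightarrow> 'b::real_normed_vector) \<Rightarrow> bool" where
  "C2_on S u \<longleftrightarrow>
     (\<exists>(u' :: 'a \<Rightarrow> 'a \<Rightarrow>\<^sub>L 'b) (u'' :: 'a \<Rightarrow> 'a \<Rightarrow>\<^sub>L ('a \<Rightarrow>\<^sub>L 'b)).
        (\<forall>z\<in>S. (u has_derivative blinfun_apply (u' z)) (at z)) \<and>
        (\<forall>z\<in>S. (u' has_derivative blinfun_apply (u'' z)) (at z)) \<and>
        continuous_on S u'')"

text \<open>
  The Wirtinger operators \<open>\<partial>/\<partial>z\<^sub>j\<close> and \<open>\<partial>/\<partial>\<bar>z\<^sub>k\<close>, where \<open>z\<^sub>j = x\<^sub>j + i y\<^sub>j\<close>.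
\<close>

definition wirtinger :: "'n \<Rightarrow> (complex^'n \<Rightarrow> complex) \<Rightarrow> complex^'n \<Rightarrow> complex" where
  "wirtinger j f z =
     (frechet_derivative f (at z) (axis j 1) - \<i> * frechet_derivative f (at z) (axis j \<i>)) / 2"

definition wirtinger_bar :: "'n \<Rightarrow> (complex^'n \<Rightarrow> complex) \<Rightarrow> complex^'n \<Rightarrow> complex" where
  "wirtinger_bar k f z =
     (frechet_derivative f (at z) (axis k 1) + \<i> * frechet_derivative f (at z) (axis k \<i>)) / 2"

text \<open>
  For a real function \<open>u\<close> of class \<open>C\<^sup>2\<close> the coefficient matrix is Hermitian, so the sum below is
  real and \<open>Re\<close> only changes its type.
\<close>

definition levi_form :: "(complex^'n \<Rightarrow> real) \<Rightarrow> complex^'n \<Rightarrow> complex^'n \<Rightarrow> real" where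
  "levi_form u z v =
     Re (\<Sum>j\<in>UNIV. \<Sum>k\<in>UNIV.
           wirtinger j (wirtinger_bar k (\<lambda>w. complex_of_real (u w))) z * v $ j * cnj (v $ k))"


section \<open>The complex projective plane\<close>

definition proj_rel :: "complex^3 \<Rightarrow> complex^3 \<Rightarrow> bool" where
  "proj_rel v w \<longleftrightarrow> v \<noteq> 0 \<and> w \<noteq> 0 \<and> (\<exists>c. c \<noteq> 0 \<and> w = c *s v)"

text \<open>
  The relation is partial: it is not reflexive at \<open>0\<close>, so \<open>cp2\<close> is the set of its classes in
  \<open>\<complex>\<^sup>3 - {0}\<close>, and \<open>cp2_point v\<close> is \<open>[v\<^sub>1 : v\<^sub>2 : v\<^sub>3]\<close> for \<open>v \<noteq> 0\<close> (and meaningless for \<open>v = 0\<close>).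
\<close>

quotient_type cp2 = "complex^3" / partial: proj_rel
  morphisms cp2_rep cp2_point
proof (rule part_equivpI)
  show "\<exists>v. proj_rel v v"
    by (rule exI[of _ "axis 1 1"]) (auto simp: proj_rel_def axis_eq_0_iff intro!: exI[of _ 1])
  show "symp proj_rel"
  proof (rule sympI)
    fix v w assume "proj_rel v w"
    then obtain c where c: "v \<noteq> 0" "w \<noteq> 0" "c \<noteq> 0" "w = c *s v"
      by (auto simp: proj_rel_def)
    then have "v = inverse c *s w" by (simp add: vector_smult_assoc)
    with c show "proj_rel w v"
      unfolding proj_rel_def by (metis nonzero_imp_inverse_nonzero)
  qed
  show "transp proj_rel"
  proof (rule transpI)
    fix u v w assume "proj_rel u v" "proj_rel v w"
    then obtain c d where "u \<noteq> 0" "w \<noteq> 0" "c \<noteq> 0" "d \<noteq> 0" "v = c *s u" "w = d *s v"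
      by (auto simp: proj_rel_def)
    then show "proj_rel u w"
      by (auto simp: proj_rel_def vector_smult_assoc intro!: exI[of _ "d * c"])
  qed
qed

text \<open>The quotient topology of \<open>\<complex>\<^sup>3 - {0}\<close>, which is open in \<open>\<complex>\<^sup>3\<close>.\<close>

instantiation cp2 :: topological_space
begin

definition open_cp2 :: "cp2 set \<Rightarrow> bool" where
  "open_cp2 U \<longleftrightarrow> open {v. v \<noteq> 0 \<and> cp2_point v \<in> U}"

instance
proof
  have "{v::complex^3. v \<noteq> 0 \<and> cp2_point v \<in> UNIV} = - {0}" by auto
  then show "open (UNIV :: cp2 set)" by (simp add: open_cp2_def open_Compl)
next
  fix S T :: "cp2 set" assume "open S" "open T"
  moreover have "{v. v \<noteq> 0 \<and> cp2_point v \<in> S \<inter> T} =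
      {v. v \<noteq> 0 \<and> cp2_point v \<in> S} \<inter> {v. v \<noteq> 0 \<and> cp2_point v \<in> T}" by auto
  ultimately show "open (S \<inter> T)" by (simp only: open_cp2_def open_Int)
next
  fix K :: "cp2 set set" assume "\<forall>S\<in>K. open S"
  moreover have "{v. v \<noteq> 0 \<and> cp2_point v \<in> \<Union>K} =
      (\<Union>S\<in>K. {v. v \<noteq> 0 \<and> cp2_point v \<in> S})" by auto
  ultimately show "open (\<Union>K)" by (simp only: open_cp2_def) (rule open_UN)
qed

end

text \<open>
  The inverses of the three standard affine charts:
  \<open>[1 : z\<^sub>1 : z\<^sub>2]\<close>, \<open>[z\<^sub>1 : 1 : z\<^sub>2]\<close> and \<open>[z\<^sub>1 : z\<^sub>2 : 1]\<close>. Each is injective on \<open>\<complex>\<^sup>2\<close>.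
\<close>

definition affine_param :: "3 \<Rightarrow> complex^2 \<Rightarrow> cp2" where
  "affine_param i z = cp2_point
     (if i = 1 then vector [1, z $ 1, z $ 2]
      else if i = 2 then vector [z $ 1, 1, z $ 2]
      else vector [z $ 1, z $ 2, 1])"

text \<open>
  Local holomorphic coordinates \<open>\<phi>\<close> on \<open>U\<close>, i.e. the charts of the maximal holomorphic atlas
  containing the affine ones: homeomorphisms onto an open subset of \<open>\<complex>\<^sup>2\<close> whose coordinate changes
  with the affine charts are holomorphic in both directions.
\<close>

definition holo_coords :: "cp2 set \<Rightarrow> (cp2 \<Rightarrow> complex^2) \<Rightarrow> bool" where
  "holo_coords U \<phi> \<longleftrightarrow>
     open U \<and> open (\<phi> ` U) \<and> inj_on \<phi> U \<and> homeomorphism U (\<phi> ` U) \<phi> (inv_into U \<phi>) \<and>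
     (\<forall>i. holo_map_on (affine_param i -` U) (\<phi> \<circ> affine_param i) \<and>
          holo_map_on (\<phi> ` (U \<inter> range (affine_param i))) (inv (affine_param i) \<circ> inv_into U \<phi>))"

text \<open>In the following two definitions \<open>X\<close> is meant to be open.\<close>

definition cp2_holomorphic_on :: "cp2 set \<Rightarrow> (cp2 \<Rightarrow> complex) \<Rightarrow> bool" where
  "cp2_holomorphic_on X f \<longleftrightarrow> (\<forall>i. holo_fun_on (affine_param i -` X) (f \<circ> affine_param i))"

definition strongly_psh_on :: "cp2 set \<Rightarrow> (cp2 \<Rightarrow> real) \<Rightarrow> bool" where
  "strongly_psh_on X \<rho> \<longleftrightarrow>
     (\<forall>U \<phi>. holo_coords U \<phi> \<longrightarrow>
        C2_on (\<phi> ` (U \<inter> X)) (\<rho> \<circ> inv_into U \<phi>) \<and>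
        (\<forall>p \<in> U \<inter> X. \<forall>v. v \<noteq> 0 \<longrightarrow> levi_form (\<rho> \<circ> inv_into U \<phi>) (\<phi> p) v > 0))"

end

theory Submission
  imports Defs "HOL-Complex_Analysis.Conformal_Mappings"
begin

text \<open>
  In homogeneous coordinates \<open>[x : y : z]\<close> the domain is the union of the tube \<open>\<bar>y\<bar> < \<bar>z\<bar>\<close>, the tube
  \<open>\<bar>y\<bar> > 2 \<bar>z\<bar>\<close>, \<open>x \<noteq> 0\<close>, and a bridge between them on which \<open>1 < \<bar>x/z\<bar> < 5/4\<close>. It is invariant under
  the torus and meets all three coordinate lines, so only constant Laurent monomials are holomorphic
  on it: for fixed small \<open>x\<^sub>0\<close> the Cauchy integral of \<open>f\<close> over a circle \<open>\<bar>x/z\<bar> = 9/8\<close> is an entire function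
  of \<open>y/z\<close> that continues \<open>f\<close>; for \<open>\<bar>y/z\<bar> > 2\<close> the circle can be inflated to radius \<open>9/8 \<bar>y/z\<bar>\<close>, and
  the rescaled integral converges as \<open>y/z \<rightarrow> \<infinity>\<close> to a limit independent of \<open>x\<^sub>0\<close>. Liouville's theorem and
  analytic continuation finish the argument.

  On the first tube \<open>\<rho> = \<bar>x/z\<bar>\<^sup>2 + \<bar>y/z\<bar>\<^sup>2\<close> is strongly plurisubharmonic, on the second one
  \<open>9 \<bar>y/x\<bar>\<^sup>2 + \<bar>z/x\<bar>\<^sup>2 - 10\<close> is. Along the bridge the larger of the two changes from the first to the
  second, so there a regularized maximum joins them.
\<close>

section \<open>Holomorphic functions of several variables are smooth\<close>

text \<open>A complex linear form bundled as a bounded real-linear map, so that continuity of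
  derivatives can be stated in the operator norm.\<close>

lift_definition cform :: "complex^'n \<Rightarrow> (complex^'n) \<Rightarrow>\<^sub>L complex"
  is "\<lambda>a v. \<Sum>j\<in>UNIV. a $ j * v $ j"
  by (intro bounded_linear_sum bounded_linear_const_mult bounded_linear_vec_nth)

lemma bounded_linear_cform: "bounded_linear (cform :: complex^'n \<Rightarrow> _)"
  by (rule linear_conv_bounded_linear[THEN iffD1], rule linearI)
     (auto intro!: blinfun_eqI simp: cform.rep_eq blinfun.bilinear_simps ring_distribs sum.distrib scaleR_sum_right)

lemmas continuous_on_cform [continuous_intros] =
  bounded_linear.continuous_on[OF bounded_linear_cform]

lemma cform_axis [simp]: "cform a (axis j w) = a $ j * w"
proof -
  have "(\<Sum>k\<in>UNIV. a $ k * axis j w $ k) = (\<Sum>k\<in>UNIV. if k = j then a $ k * w else 0)"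
    by (rule sum.cong) (auto simp: axis_def)
  then show ?thesis by (simp add: cform.rep_eq)
qed

lemma holo_fun_onD:
  assumes "holo_fun_on S h"
  obtains a where "\<And>z. z \<in> S \<Longrightarrow> (h has_derivative cform (a z)) (at z)"
  using assms unfolding holo_fun_on_def cform.rep_eq by metis

lemma bounded_linear_axis: "bounded_linear (axis j :: complex \<Rightarrow> complex^'n)"
  by (rule linear_conv_bounded_linear[THEN iffD1], rule linearI)
     (auto simp: axis_def vec_eq_iff)

lemma norm_axis_complex [simp]: "norm (axis j w :: complex^'n) = cmod w"
proof -
  have "(\<Sum>i\<in>UNIV. (cmod (axis j w $ i))\<^sup>2) = (\<Sum>i\<in>UNIV. if i = j then (cmod w)\<^sup>2 else 0)"
    by (rule sum.cong) (auto simp: axis_def)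
  then show ?thesis by (simp add: norm_vec_def L2_set_def)
qed

lemmas continuous_on_axis [continuous_intros] = bounded_linear.continuous_on[OF bounded_linear_axis]

text \<open>Restriction to a coordinate line makes the one-variable Cauchy theory available.\<close>

lemma cform_line:
  fixes z :: "complex^'n"
  assumes "(h has_derivative cform a) (at (z + axis j w))"
  shows "((\<lambda>w. h (z + axis j w)) has_field_derivative a $ j) (at w)"
proof -
  have "((\<lambda>w. z + axis j w) has_derivative axis j) (at w)"
    by (auto intro!: derivative_eq_intros bounded_linear.has_derivative[OF bounded_linear_axis])
  from diff_chain_at[OF this assms] show ?thesis
    by (simp add: o_def has_field_derivative_def mult.commute[of _ "a $ j"])
qed

section \<open>Cauchy integrals over circles as integrals over the unit interval\<close>

definition unit_circle :: "real \<Rightarrow> complex" where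
  "unit_circle t = exp (2 * of_real pi * \<i> * of_real t)"

lemma norm_unit_circle [simp]: "cmod (unit_circle t) = 1"
  by (simp add: unit_circle_def)

lemma unit_circle_nonzero [simp]: "unit_circle t \<noteq> 0"
  by (simp add: unit_circle_def)

lemma continuous_on_unit_circle [continuous_intros]:
  "continuous_on S f \<Longrightarrow> continuous_on S (\<lambda>x. unit_circle (f x))"
  unfolding unit_circle_def by (intro continuous_intros)

text \<open>On the circle \<open>dz = 2 pi i z dt\<close>. Over the fixed interval
  \<open>{0..1}\<close> the integrals can be differentiated with respect to parameters.\<close>

lemma contour_integral_circlepath_unit_circle:
  "contour_integral (circlepath 0 r) g =
     2 * of_real pi * \<i> * integral {0..1} (\<lambda>t. g (of_real r * unit_circle t) * (of_real r * unit_circle t))"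
proof -
  have "contour_integral (circlepath 0 r) g =
      integral {0..1} (\<lambda>t. (2 * of_real pi * \<i>) * (g (of_real r * unit_circle t) * (of_real r * unit_circle t)))"
    unfolding contour_integral_integral
    by (rule integral_cong, subst vector_derivative_circlepath)
       (simp add: circlepath unit_circle_def algebra_simps)
  then show ?thesis by simp
qed

text \<open>Cauchy's formula for the first derivative on the \<open>j\<close>-th coordinate line.
  The radius can stay fixed while \<open>z\<close> varies, so that the dependence on
  \<open>z\<close> sits in the integrand alone.\<close>

lemma partial_eq_integral:
  fixes h :: "complex^'n \<Rightarrow> complex"
  assumes der: "\<And>z. z \<in> S \<Longrightarrow> (h has_derivative cform (a z)) (at z)"
    and sub: "cball z r \<subseteq> S" and r: "r > 0"
  shows "a z $ j = integral {0..1} (\<lambda>t. h (z + axis j (of_real r * unit_circle t)) / (of_real r * unit_circle t))"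
proof -
  define g where "g = (\<lambda>w. h (z + axis j w))"
  have g: "(g has_field_derivative a (z + axis j w) $ j) (at w)" if "w \<in> cball 0 r" for w
    unfolding g_def
  proof (rule cform_line, rule der)
    have "dist z (z + axis j w) \<le> r"
      using that by (simp add: dist_norm)
    then show "z + axis j w \<in> S"
      using sub by auto
  qed
  have hol: "g holomorphic_on cball 0 r"
    using g by (meson field_differentiable_at_within field_differentiable_def holomorphic_onI)
  have "(g has_field_derivative (1 / (2 * of_real pi * \<i>) * contour_integral(circlepath 0 r) (\<lambda>u. g u / (u-0)^2))) (at 0)"
    by (rule Cauchy_derivative_integral_circlepath)
       (use hol r in \<open>auto intro: holomorphic_on_imp_continuous_on holomorphic_on_subset\<close>)
  with g[of 0] r have "a z $ j = 1 / (2 * of_real pi * \<i>) * contour_integral(circlepath 0 r) (\<lambda>u. g u / (u-0)^2)"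
    by (simp add: DERIV_unique axis_eq_0_iff[THEN iffD2])
  also have "\<dots> = integral {0..1} (\<lambda>t. g (of_real r * unit_circle t) / (of_real r * unit_circle t))"
    using r by (simp add: contour_integral_circlepath_unit_circle power2_eq_square)
  finally show ?thesis by (simp add: g_def)
qed

lemma holo_fun_on_imp_continuous_on: "holo_fun_on S f \<Longrightarrow> continuous_on S f"
  by (meson continuous_at_imp_continuous_on has_derivative_continuous holo_fun_on_def)

text \<open>The Cauchy integral over a circle of fixed radius around the moving point is differentiated
  twice: the first time it is merely continuous in the point, which makes \<open>h\<close> of class \<open>C\<^sup>1\<close> and
  so allows differentiation under the integral.\<close>

lemma partial_holo:
  fixes h :: "complex^'n \<Rightarrow> complex"
  assumes der: "\<And>z. z \<in> S \<Longrightarrow> (h has_derivative cform (a z)) (at z)" and S: "open S"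
  shows "continuous_on S a" and "holo_fun_on S (\<lambda>z. a z $ j)"
proof -
  have conth: "continuous_on S h"
    using der by (meson continuous_at_imp_continuous_on has_derivative_continuous)
  \<comment> \<open>The factor 2 leaves room for the centre to move by \<open>r\<close> and for the
    circle of radius \<open>r\<close> around it.\<close>
  have nbhd: "\<exists>r>0. cball z (2 * r) \<subseteq> S" if zS: "z \<in> S" for z
  proof -
    obtain e where e: "e > 0" "cball z e \<subseteq> S"
      using S zS by (meson open_contains_cball)
    then have "e / 2 > 0" "cball z (2 * (e / 2)) \<subseteq> S" by simp_all
    then show ?thesis by blast
  qed
  have shift: "z + axis j (of_real r * unit_circle t) \<in> cball z0 (2 * r)" and
       sub: "cball z r \<subseteq> cball z0 (2 * r)" if "z \<in> ball z0 r" for z z0 :: "complex^'n" and j r t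
  proof -
    have "r > 0" using le_less_trans[OF zero_le_dist, of z0 z r] that by simp
    then show "z + axis j (of_real r * unit_circle t) \<in> cball z0 (2 * r)"
      using that norm_triangle_ineq4[of "z0 - z" "axis j (of_real r * unit_circle t)"]
      by (simp add: dist_norm norm_mult algebra_simps)
    show "cball z r \<subseteq> cball z0 (2 * r)"
      using that by (simp add: cball_subset_cball_iff dist_commute)
  qed
  have local: "a z $ j = integral (cbox 0 1) (\<lambda>t. h (z + axis j (of_real r * unit_circle t)) / (of_real r * unit_circle t))"
    if "cball z0 (2 * r) \<subseteq> S" "z \<in> ball z0 r" "r > 0" for z z0 r j
    using partial_eq_integral[OF der _ that(3)] sub[OF that(2)] that(1) by (simp add: cbox_interval)
  have cj: "continuous_on S (\<lambda>z. a z $ j)" for j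
  proof (subst continuous_on_eq_continuous_at[OF S], safe)
    fix z0 assume "z0 \<in> S"
    then obtain r where r: "r > 0" "cball z0 (2 * r) \<subseteq> S" using nbhd by blast
    have "continuous_on (ball z0 r) (\<lambda>z. integral (cbox 0 1) (\<lambda>t. h (z + axis j (of_real r * unit_circle t)) / (of_real r * unit_circle t)))"
      by (rule integral_continuous_on_param, unfold split_beta, 
          intro continuous_intros continuous_on_compose2[OF conth])
         (use r shift in \<open>auto intro!: continuous_intros\<close>)
    then have "continuous_on (ball z0 r) (\<lambda>z. a z $ j)"
      by (rule continuous_on_eq) (use local[OF r(2) _ r(1)] in simp)
    then show "isCont (\<lambda>z. a z $ j) z0"
      using r(1) by (simp add: continuous_on_eq_continuous_at)
  qed
  then show ca: "continuous_on S a"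
    using continuous_on_vec_lambda[of S "\<lambda>i z. a z $ i"] by simp
  show "holo_fun_on S (\<lambda>z. a z $ j)"
    unfolding holo_fun_on_def
  proof
    fix z0 assume "z0 \<in> S"
    then obtain r where r: "r > 0" "cball z0 (2 * r) \<subseteq> S" using nbhd by blast
    define c where "c = (\<lambda>t. 1 / (of_real r * unit_circle t))"
    define p where "p = (\<lambda>z t. z + axis j (of_real r * unit_circle t))"
    define fx where "fx = (\<lambda>z t. cform (c t *s a (p z t)))"
    have pS: "p z t \<in> S" if "z \<in> ball z0 r" for z t
      using shift[OF that] r by (auto simp: p_def)
    have cc: "continuous_on T c" for T
      unfolding c_def using r by (intro continuous_intros) auto
    have cca: "continuous_on (ball z0 r \<times> cbox 0 1) (\<lambda>x. c (snd x) * a (p (fst x) (snd x)) $ k)" for k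
      by (intro continuous_intros continuous_on_compose2[OF ca] continuous_on_compose2[OF cc[of UNIV]])
         (use pS in \<open>auto simp: p_def intro!: continuous_intros\<close>)
    have "((\<lambda>z. integral (cbox 0 1) (\<lambda>t. h (p z t) * c t)) has_derivative
        integral (cbox 0 1) (fx z0)) (at z0 within ball z0 r)"
    proof (rule leibniz_rule)
      fix z and t :: real assume z: "z \<in> ball z0 r"
      have "((\<lambda>z. p z t) has_derivative (\<lambda>v. v)) (at z)"
        unfolding p_def by (auto intro!: derivative_eq_intros)
      from diff_chain_at[OF this der[OF pS[OF z]]]
      have "((\<lambda>z. h (p z t)) has_derivative cform (a (p z t))) (at z)"
        by (simp add: o_def)
      then have "((\<lambda>z. h (p z t) * c t) has_derivative (\<lambda>v. cform (a (p z t)) v * c t)) (at z)"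
        by (auto intro!: derivative_eq_intros)
      moreover have "(\<lambda>v. cform (a (p z t)) v * c t) = fx z t"
        by (auto simp: fx_def cform.rep_eq sum_distrib_left sum_distrib_right algebra_simps)
      ultimately show "((\<lambda>z. h (p z t) * c t) has_derivative fx z t) (at z within ball z0 r)"
        by (simp add: has_derivative_at_withinI)
    next
      fix z assume z: "z \<in> ball z0 r"
      show "(\<lambda>t. h (p z t) * c t) integrable_on cbox 0 1"
        by (intro integrable_continuous continuous_intros cc continuous_on_compose2[OF conth])
           (use pS[OF z] in \<open>auto simp: p_def intro!: continuous_intros\<close>)
    next
      show "continuous_on (ball z0 r \<times> cbox 0 1) (\<lambda>(z, t). fx z t)"
        unfolding fx_def split_beta
        by (intro continuous_intros, subst vector_scalar_mult_def, intro continuous_on_vec_lambda cca)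
    qed (use r in auto)
    then have "((\<lambda>z. a z $ j) has_derivative integral (cbox 0 1) (fx z0)) (at z0 within ball z0 r)"
      by (rule has_derivative_transform[rotated 2])
         (use r local[OF r(2) _ r(1)] in \<open>auto simp: p_def c_def\<close>)
    then have "((\<lambda>z. a z $ j) has_derivative integral (cbox 0 1) (fx z0)) (at z0)"
      using r at_within_open[of z0 "ball z0 r"] by simp
    \<comment> \<open>The derivative is an integral of forms. Evaluation at \<open>v\<close>
      commutes with the integral, which exhibits it as the complex linear form with integrated
      coefficients.\<close>
    moreover have "blinfun_apply (integral (cbox 0 1) (fx z0)) =
      (\<lambda>v. \<Sum>k\<in>UNIV. (\<chi> k. integral (cbox 0 1) (\<lambda>t. c t * a (p z0 t) $ k)) $ k * v $ k)"
    proof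
      fix v
      have ck: "(\<lambda>t. c t * a (p z0 t) $ k) integrable_on cbox 0 1" for k
        by (intro integrable_continuous continuous_intros cc continuous_on_compose2[OF ca])
           (use pS[of z0] r in \<open>auto simp: p_def intro!: continuous_intros\<close>)
      have "fx z0 integrable_on cbox 0 1"
        unfolding fx_def
        by (intro integrable_continuous continuous_intros, subst vector_scalar_mult_def, 
            intro continuous_on_vec_lambda continuous_intros cc continuous_on_compose2[OF ca])
           (use pS[of z0] r in \<open>auto simp: p_def intro!: continuous_intros\<close>)
      have "bounded_linear (\<lambda>F :: (complex^'n) \<Rightarrow>\<^sub>L complex. F v)"
        by (intro bounded_linear_intros)
      from integral_linear[OF \<open>fx z0 integrable_on cbox 0 1\<close> this]
      have "blinfun_apply (integral (cbox 0 1) (fx z0)) v = integral (cbox 0 1) (\<lambda>t. \<Sum>k\<in>UNIV. c t * a (p z0 t) $ k * v $ k)"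
        by (simp add: o_def fx_def cform.rep_eq)
      also have "\<dots> = (\<Sum>k\<in>UNIV. integral (cbox 0 1) (\<lambda>t. c t * a (p z0 t) $ k * v $ k))"
        by (rule integral_sum) (use ck in \<open>auto intro!: integrable_on_mult_left\<close>)
      finally show "blinfun_apply (integral (cbox 0 1) (fx z0)) v = (\<Sum>k\<in>UNIV. (\<chi> k. integral (cbox 0 1) (\<lambda>t. c t * a (p z0 t) $ k)) $ k * v $ k)"
        by simp
    qed
    ultimately show "\<exists>b. ((\<lambda>z. a z $ j) has_derivative (\<lambda>v. \<Sum>k\<in>UNIV. b $ k * v $ k)) (at z0)"
      by (auto simp only: intro!: exI)
  qed
qed

section \<open>The Levi form of functions of class \<open>C\<^sup>2\<close>\<close>

text \<open>Exposes the derivatives that \<open>C2_on\<close> quantifies away, since Levi forms are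
  computed from \<open>u''\<close>.\<close>

definition C2_data :: "'a::real_normed_vector set \<Rightarrow> ('a \<Rightarrow> real) \<Rightarrow>
    ('a \<Rightarrow> 'a \<Rightarrow>\<^sub>L real) \<Rightarrow> ('a \<Rightarrow> 'a \<Rightarrow>\<^sub>L ('a \<Rightarrow>\<^sub>L real)) \<Rightarrow> bool" where
  "C2_data S u u' u'' \<longleftrightarrow>
     (\<forall>z\<in>S. (u has_derivative blinfun_apply (u' z)) (at z)) \<and>
     (\<forall>z\<in>S. (u' has_derivative blinfun_apply (u'' z)) (at z)) \<and>
     continuous_on S u''"

lemma C2_on_data: "C2_on S u \<longleftrightarrow> (\<exists>u' u''. C2_data S u u' u'')"
  by (simp add: C2_on_def C2_data_def)

lemma C2_dataD:
  assumes "C2_data S u u' u''" "z \<in> S"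
  shows "(u has_derivative blinfun_apply (u' z)) (at z)"
    and "(u' has_derivative blinfun_apply (u'' z)) (at z)"
  using assms by (auto simp: C2_data_def)

lemma C2_data_continuous_on:
  assumes "C2_data S u u' u''"
  shows "continuous_on S u" "continuous_on S u'" "continuous_on S u''"
  using assms unfolding C2_data_def
  by (meson continuous_at_imp_continuous_on has_derivative_continuous)+

text \<open>Half the average of the quadratic form over \<open>v\<close> and
  \<open>\<i> *s v\<close>. For a real Hessian this is the part invariant under multiplication by
  \<open>\<i>\<close>, that is, the Levi form.\<close>

definition hermitian_part :: "((complex^'n) \<Rightarrow>\<^sub>L ((complex^'n) \<Rightarrow>\<^sub>L real)) \<Rightarrow> complex^'n \<Rightarrow> real" where
  "hermitian_part B v = (B v v + B (\<i> *s v) (\<i> *s v)) / 4"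

lemma axis_expand: "(axis j c :: complex^'n) = Re c *\<^sub>R axis j 1 + Im c *\<^sub>R axis j \<i>"
  by (simp add: vec_eq_iff axis_def complex_eq_iff)

lemma vec_expand: "v = (\<Sum>j\<in>UNIV. axis j (v $ j))" for v :: "complex^'n"
  by (simp add: vec_eq_iff axis_def if_distrib cong: if_cong)

text \<open>The coefficient is what the two Wirtinger operators extract from \<open>B\<close>. The
  identity holds summand by summand, after expanding over the real basis vectors
  \<open>axis j 1\<close> and \<open>axis j \<i>\<close>.\<close>

lemma hermitian_part_expand:
  fixes B :: "(complex^'n) \<Rightarrow>\<^sub>L ((complex^'n) \<Rightarrow>\<^sub>L real)"
  shows "hermitian_part B v = Re (\<Sum>j\<in>UNIV. \<Sum>k\<in>UNIV.
     (((of_real (B (axis j 1) (axis k 1)) + \<i> * of_real (B (axis j 1) (axis k \<i>))) / 2 -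
       \<i> * ((of_real (B (axis j \<i>) (axis k 1)) + \<i> * of_real (B (axis j \<i>) (axis k \<i>))) / 2)) / 2) * v $ j * cnj (v $ k))"
proof -
  have expand: "B v v = (\<Sum>j\<in>UNIV. \<Sum>k\<in>UNIV. B (axis j (v $ j)) (axis k (v $ k)))" for v
    by (subst (1 2) vec_expand) (simp add: blinfun.sum_left blinfun.sum_right, rule sum.swap)
  have pair: "(B (axis j x) (axis k y) + B (axis j (\<i> * x)) (axis k (\<i> * y))) / 4 =
     Re ((((of_real (B (axis j 1) (axis k 1)) + \<i> * of_real (B (axis j 1) (axis k \<i>))) / 2 -
       \<i> * ((of_real (B (axis j \<i>) (axis k 1)) + \<i> * of_real (B (axis j \<i>) (axis k \<i>))) / 2)) / 2) * x * cnj y)"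
    for j k x y
    unfolding axis_expand[of _ x] axis_expand[of _ y] axis_expand[of _ "\<i> * x"] axis_expand[of _ "\<i> * y"]
    by (simp add: blinfun.bilinear_simps field_simps)
  have "hermitian_part B v = (\<Sum>j\<in>UNIV. \<Sum>k\<in>UNIV.
      (B (axis j (v $ j)) (axis k (v $ k)) + B (axis j (\<i> * v $ j)) (axis k (\<i> * v $ k))) / 4)"
    unfolding hermitian_part_def
    by (subst (1 2) expand) (simp add: sum.distrib add_divide_distrib sum_divide_distrib)
  also have "\<dots> = (\<Sum>j\<in>UNIV. \<Sum>k\<in>UNIV.
     Re ((((of_real (B (axis j 1) (axis k 1)) + \<i> * of_real (B (axis j 1) (axis k \<i>))) / 2 -
       \<i> * ((of_real (B (axis j \<i>) (axis k 1)) + \<i> * of_real (B (axis j \<i>) (axis k \<i>))) / 2)) / 2) * v $ j * cnj (v $ k)))"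
    by (simp only: pair)
  finally show ?thesis by simp
qed

text \<open>Each Wirtinger operator evaluates a derivative at \<open>axis j 1\<close> and
  \<open>axis j \<i>\<close>. The inner one is computed on all of the open set \<open>S\<close>,
  since it is differentiated again.\<close>

lemma levi_form_eq:
  fixes u :: "complex^'n \<Rightarrow> real"
  assumes u: "C2_data S u u' u''" and S: "open S" "z \<in> S"
  shows "levi_form u z v = hermitian_part (u'' z) v"
proof -
  have wb: "wirtinger_bar k (\<lambda>w. complex_of_real (u w)) w =
      (of_real (u' w (axis k 1)) + \<i> * of_real (u' w (axis k \<i>))) / 2" if "w \<in> S" for k w
  proof -
    have "((\<lambda>w. complex_of_real (u w)) has_derivative (\<lambda>v. complex_of_real (u' w v))) (at w)"
      using C2_dataD(1)[OF u that] by (rule has_derivative_of_real)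
    then show ?thesis
      unfolding wirtinger_bar_def by (simp add: frechet_derivative_at[symmetric])
  qed
  have w: "wirtinger j (wirtinger_bar k (\<lambda>w. complex_of_real (u w))) z =
     (((of_real (u'' z (axis j 1) (axis k 1)) + \<i> * of_real (u'' z (axis j 1) (axis k \<i>))) / 2 -
       \<i> * ((of_real (u'' z (axis j \<i>) (axis k 1)) + \<i> * of_real (u'' z (axis j \<i>) (axis k \<i>))) / 2)) / 2)" for j k
  proof -
    have app: "((\<lambda>w. u' w x) has_derivative (\<lambda>v. u'' z v x)) (at z)" for x
      using bounded_linear.has_derivative[OF bounded_bilinear.bounded_linear_left[OF bounded_bilinear_blinfun_apply] C2_dataD(2)[OF u S(2)]]
      by simp
    have "((\<lambda>w. (of_real (u' w (axis k 1)) + \<i> * of_real (u' w (axis k \<i>))) / 2) has_derivative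
       (\<lambda>v. (of_real (u'' z v (axis k 1)) + \<i> * of_real (u'' z v (axis k \<i>))) / 2)) (at z)"
      by (intro bounded_linear.has_derivative[OF bounded_linear_divide] has_derivative_add
          has_derivative_mult_right has_derivative_of_real app)
    then have "(wirtinger_bar k (\<lambda>w. complex_of_real (u w)) has_derivative
       (\<lambda>v. (of_real (u'' z v (axis k 1)) + \<i> * of_real (u'' z v (axis k \<i>))) / 2)) (at z)"
      by (rule has_derivative_transform_within_open[OF _ S]) (simp add: wb)
    then show ?thesis
      unfolding wirtinger_def by (simp add: frechet_derivative_at[symmetric])
  qed
  show ?thesis
    unfolding levi_form_def hermitian_part_expand w ..
qed

section \<open>Calculus of twice continuously differentiable functions\<close>

lemma C2_data_const: "C2_data S (\<lambda>_. c) (\<lambda>_. 0) (\<lambda>_. 0)"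
  by (auto simp: C2_data_def zero_blinfun.rep_eq[abs_def])

lemma C2_data_add:
  assumes "C2_data S u u' u''" "C2_data S w w' w''"
  shows "C2_data S (\<lambda>z. u z + w z) (\<lambda>z. u' z + w' z) (\<lambda>z. u'' z + w'' z)"
  using assms unfolding C2_data_def
  by (auto intro!: derivative_eq_intros continuous_intros simp: blinfun.bilinear_simps)

lemma C2_data_cmult:
  assumes "C2_data S u u' u''"
  shows "C2_data S (\<lambda>z. c * u z) (\<lambda>z. c *\<^sub>R u' z) (\<lambda>z. c *\<^sub>R u'' z)"
  using assms unfolding C2_data_def
  by (auto intro!: derivative_eq_intros continuous_intros simp: blinfun.bilinear_simps)

text \<open>The chain rule applied twice. The term \<open>blinfun_scaleR_left l o\<^sub>L l\<close>
  is the rank-one form sending \<open>v\<close> and \<open>w\<close> to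
  \<open>l v * l w\<close>.\<close>

lemma C2_data_compose:
  assumes u: "C2_data S u u' u''"
    and th: "\<And>x. (\<theta> has_real_derivative \<theta>' x) (at x)" "\<And>x. (\<theta>' has_real_derivative \<theta>'' x) (at x)"
      "continuous_on UNIV \<theta>''"
  shows "C2_data S (\<lambda>z. \<theta> (u z)) (\<lambda>z. \<theta>' (u z) *\<^sub>R u' z)
    (\<lambda>z. \<theta>'' (u z) *\<^sub>R (blinfun_scaleR_left (u' z) o\<^sub>L u' z) + \<theta>' (u z) *\<^sub>R u'' z)"
  unfolding C2_data_def
proof (intro conjI ballI)
  fix z assume z: "z \<in> S"
  note d = C2_dataD[OF u z]
  have "(\<theta> has_derivative (\<lambda>x. \<theta>' (u z) * x)) (at (u z))"
    using th(1) by (simp add: has_field_derivative_def)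
  from diff_chain_at[OF d(1) this]
  show "((\<lambda>z. \<theta> (u z)) has_derivative blinfun_apply (\<theta>' (u z) *\<^sub>R u' z)) (at z)"
    by (simp add: o_def blinfun.scaleR_left[abs_def])
  have "(\<theta>' has_derivative (\<lambda>x. \<theta>'' (u z) * x)) (at (u z))"
    using th(2) by (simp add: has_field_derivative_def)
  from diff_chain_at[OF d(1) this]
  have "((\<lambda>z. \<theta>' (u z)) has_derivative (\<lambda>v. \<theta>'' (u z) * u' z v)) (at z)"
    by (simp add: o_def)
  from has_derivative_scaleR[OF this d(2)]
  show "((\<lambda>z. \<theta>' (u z) *\<^sub>R u' z) has_derivative
     blinfun_apply (\<theta>'' (u z) *\<^sub>R (blinfun_scaleR_left (u' z) o\<^sub>L u' z) + \<theta>' (u z) *\<^sub>R u'' z)) (at z)"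
    by (rule has_derivative_eq_rhs)
       (auto simp: fun_eq_iff blinfun.bilinear_simps intro!: blinfun_eqI)
next
  have "continuous_on UNIV \<theta>'"
    using th(2) by (meson DERIV_continuous continuous_at_imp_continuous_on)
  then have "continuous_on S (\<lambda>z. \<theta>' (u z))" "continuous_on S (\<lambda>z. \<theta>'' (u z))"
    using th(3) C2_data_continuous_on(1)[OF u] by (auto intro: continuous_on_compose2)
  then show "continuous_on S (\<lambda>z. \<theta>'' (u z) *\<^sub>R (blinfun_scaleR_left (u' z) o\<^sub>L u' z) + \<theta>' (u z) *\<^sub>R u'' z)"
    using C2_data_continuous_on[OF u]
    by (intro continuous_on_add continuous_on_scaleR bounded_bilinear.continuous_on[OF bounded_bilinear_blinfun_compose]
          bounded_linear.continuous_on[OF bounded_linear_blinfun_scaleR_left])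
qed

lemma hermitian_part_simps [simp]:
  "hermitian_part 0 v = 0"
  "hermitian_part (A + B) v = hermitian_part A v + hermitian_part B v"
  "hermitian_part (c *\<^sub>R A) v = c * hermitian_part A v"
  "hermitian_part (blinfun_scaleR_left l o\<^sub>L l) v = ((l v)\<^sup>2 + (l (\<i> *s v))\<^sup>2) / 4"
  by (simp_all add: hermitian_part_def blinfun.bilinear_simps field_simps power2_eq_square)

text \<open>Linear in \<open>w\<close> too, so the real derivative of \<open>Re h\<close> is a
  bounded linear image of the complex partials and can be differentiated once more.\<close>

lift_definition re_coord :: "'n \<Rightarrow> complex \<Rightarrow> (complex^'n) \<Rightarrow>\<^sub>L real" is "\<lambda>j w v. Re (w * v $ j)"
  by (intro bounded_linear_compose[OF bounded_linear_Re] bounded_linear_const_mult bounded_linear_vec_nth)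

lemma bounded_linear_re_coord: "bounded_linear (re_coord j :: complex \<Rightarrow> (complex^'n) \<Rightarrow>\<^sub>L real)"
  by (rule linear_conv_bounded_linear[THEN iffD1], rule linearI)
     (auto intro!: blinfun_eqI simp: re_coord.rep_eq blinfun.bilinear_simps algebra_simps)

text \<open>The real part is pluriharmonic: the partials are holomorphic by
  \<open>partial_holo\<close>, so the Hessian is the real part of a complex bilinear form. Its
  values at \<open>v\<close> and \<open>\<i> *s v\<close> are opposite and cancel.\<close>

lemma C2_data_Re_holo:
  fixes h :: "complex^'n \<Rightarrow> complex"
  assumes der: "\<And>z. z \<in> S \<Longrightarrow> (h has_derivative cform (a z)) (at z)" and S: "open S"
  obtains u' u'' where "C2_data S (\<lambda>z. Re (h z)) u' u''"
    "\<And>z v. u' z v = Re (cform (a z) v)" "\<And>z v. hermitian_part (u'' z) v = 0"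
proof -
  have "\<forall>j. \<exists>b. \<forall>z\<in>S. ((\<lambda>z. a z $ j) has_derivative cform (b z)) (at z)"
    using partial_holo(2)[OF der S] by (metis holo_fun_onD)
  then obtain b where b: "\<And>z j. z \<in> S \<Longrightarrow> ((\<lambda>z. a z $ j) has_derivative cform (b j z)) (at z)"
    by metis
  have cb: "continuous_on S (b j)" for j
    using b by (rule partial_holo(1)[OF _ S])
  define R :: "'n \<Rightarrow> complex \<Rightarrow>\<^sub>L ((complex^'n) \<Rightarrow>\<^sub>L real)" where "R j = Blinfun (re_coord j)" for j
  have R: "blinfun_apply (R j) = re_coord j" for j
    unfolding R_def by (rule bounded_linear_Blinfun_apply[OF bounded_linear_re_coord])
  define u' where "u' z = (\<Sum>j\<in>UNIV. R j (a z $ j))" for z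
  define u'' where "u'' z = (\<Sum>j\<in>UNIV. R j o\<^sub>L cform (b j z))" for z
  have u': "u' z v = Re (cform (a z) v)" for z v
    by (simp add: u'_def R re_coord.rep_eq cform.rep_eq blinfun.sum_left)
  have "hermitian_part (u'' z) v = 0" for z v
  proof -
    have "cform c (\<i> *s v) = \<i> * cform c v" for c :: "complex^'n"
      by (simp add: cform.rep_eq sum_distrib_left algebra_simps)
    then show ?thesis
      by (simp add: hermitian_part_def u''_def blinfun.sum_left R re_coord.rep_eq
            sum.distrib[symmetric] algebra_simps)
  qed
  moreover have "C2_data S (\<lambda>z. Re (h z)) u' u''"
    unfolding C2_data_def
  proof (intro conjI ballI)
    fix z assume z: "z \<in> S"
    show "((\<lambda>z. Re (h z)) has_derivative blinfun_apply (u' z)) (at z)"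
      using bounded_linear.has_derivative[OF bounded_linear_Re der[OF z]]
      by (rule has_derivative_eq_rhs) (simp add: u' fun_eq_iff)
    show "(u' has_derivative blinfun_apply (u'' z)) (at z)"
      unfolding u'_def R
      by (rule has_derivative_eq_rhs, rule has_derivative_sum,
          rule bounded_linear.has_derivative[OF bounded_linear_re_coord b[OF z]])
         (simp add: u''_def R fun_eq_iff blinfun.sum_left)
  next
    show "continuous_on S u''"
      unfolding u''_def
      by (intro continuous_on_sum bounded_bilinear.continuous_on[OF bounded_bilinear_blinfun_compose]
            continuous_on_const continuous_on_cform cb)
  qed
  ultimately show ?thesis using that u' by blast
qed

text \<open>The function is the sum of the squares of the pluriharmonic functions
  \<open>Re h\<close> and \<open>Re (- \<i> * h)\<close>, the latter being the imaginary part. Only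
  the rank-one terms of the chain rule survive, and each square contributes half of the
  result.\<close>

lemma C2_data_norm_holo:
  fixes h :: "complex^'n \<Rightarrow> complex"
  assumes der: "\<And>z. z \<in> S \<Longrightarrow> (h has_derivative cform (a z)) (at z)" and S: "open S"
  obtains u' u'' where "C2_data S (\<lambda>z. (cmod (h z))\<^sup>2) u' u''"
    "\<And>z v. hermitian_part (u'' z) v = (cmod (cform (a z) v))\<^sup>2"
proof -
  have lin: "cform c (\<i> *s v) = \<i> * cform c v" and lin2: "cform (x *s c) v = x * cform c v"
    and lin3: "cform (- c) v = - cform c v" for c v :: "complex^'n" and x
    by (simp_all add: cform.rep_eq sum_distrib_left sum_negf algebra_simps)
  obtain u' u'' where u: "C2_data S (\<lambda>z. Re (h z)) u' u''"
    "\<And>z v. u' z v = Re (cform (a z) v)" "\<And>z v. hermitian_part (u'' z) v = 0"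
    using C2_data_Re_holo[OF der S] by blast
  have der2: "((\<lambda>z. - \<i> * h z) has_derivative cform (- \<i> *s a z)) (at z)" if "z \<in> S" for z
    using has_derivative_mult_right[OF der[OF that], of "- \<i>"]
    by (rule has_derivative_eq_rhs) (rule ext, simp only: lin2)
  obtain w' w'' where w: "C2_data S (\<lambda>z. Re (- \<i> * h z)) w' w''"
    "\<And>z v. w' z v = Re (cform (- \<i> *s a z) v)" "\<And>z v. hermitian_part (w'' z) v = 0"
    using C2_data_Re_holo[OF der2 S] by blast
  have sq: "((\<lambda>x. x\<^sup>2) has_real_derivative 2 * x) (at x)" "((\<lambda>x. 2 * x) has_real_derivative 2) (at x)" for x :: real
    by (auto intro!: derivative_eq_intros)
  note c = C2_data_compose[where \<theta>="\<lambda>x. x\<^sup>2" and \<theta>'="\<lambda>x. 2 * x" and \<theta>''="\<lambda>_. 2", OF _ sq continuous_on_const]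
  note d = C2_data_add[OF c[OF u(1)] c[OF w(1)]]
  have "(\<lambda>z. (Re (h z))\<^sup>2 + (Re (- \<i> * h z))\<^sup>2) = (\<lambda>z. (cmod (h z))\<^sup>2)"
    by (simp add: cmod_power2)
  from that[OF d[unfolded this]] show ?thesis
    by (simp add: u w lin lin2 lin3 cmod_power2, simp add: field_simps)
qed

section \<open>Strong plurisubharmonicity in coordinates: sums, gluing and locality\<close>

definition spsh_on :: "(complex^'n) set \<Rightarrow> (complex^'n \<Rightarrow> real) \<Rightarrow> bool" where
  "spsh_on S u \<longleftrightarrow> (\<exists>u' u''. C2_data S u u' u'' \<and> (\<forall>z\<in>S. \<forall>v. v \<noteq> 0 \<longrightarrow> hermitian_part (u'' z) v > 0))"

lemma spsh_on_levi:
  assumes "spsh_on S u" "open S"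
  shows "C2_on S u" and "z \<in> S \<Longrightarrow> v \<noteq> 0 \<Longrightarrow> levi_form u z v > 0"
  using assms levi_form_eq unfolding spsh_on_def C2_on_data by metis+

text \<open>By \<open>inj\<close> the two differentials have no common kernel, so at least one of
  the squares in the Levi form is positive.\<close>

lemma spsh_on_norm_holo_sum:
  fixes g h :: "complex^'n \<Rightarrow> complex"
  assumes g: "\<And>z. z \<in> S \<Longrightarrow> (g has_derivative cform (a z)) (at z)"
    and h: "\<And>z. z \<in> S \<Longrightarrow> (h has_derivative cform (b z)) (at z)"
    and S: "open S" and pos: "\<alpha> > 0" "\<beta> > 0"
    and inj: "\<And>z v. z \<in> S \<Longrightarrow> cform (a z) v = 0 \<Longrightarrow> cform (b z) v = 0 \<Longrightarrow> v = 0"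
  shows "spsh_on S (\<lambda>z. \<alpha> * (cmod (g z))\<^sup>2 + \<beta> * (cmod (h z))\<^sup>2 + \<gamma>)"
proof -
  obtain u' u'' where u: "C2_data S (\<lambda>z. (cmod (g z))\<^sup>2) u' u''"
    "\<And>z v. hermitian_part (u'' z) v = (cmod (cform (a z) v))\<^sup>2"
    using C2_data_norm_holo[OF g S] by blast
  obtain w' w'' where w: "C2_data S (\<lambda>z. (cmod (h z))\<^sup>2) w' w''"
    "\<And>z v. hermitian_part (w'' z) v = (cmod (cform (b z) v))\<^sup>2"
    using C2_data_norm_holo[OF h S] by blast
  note d = C2_data_add[OF C2_data_add[OF C2_data_cmult[OF u(1), of \<alpha>] C2_data_cmult[OF w(1), of \<beta>]] C2_data_const[of S \<gamma>]]
  show ?thesis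
    unfolding spsh_on_def
  proof (intro exI conjI ballI allI impI, rule d)
    fix z v :: "complex^'n" assume "z \<in> S" "v \<noteq> 0"
    then have "cform (a z) v \<noteq> 0 \<or> cform (b z) v \<noteq> 0" using inj by blast
    then show "hermitian_part (\<alpha> *\<^sub>R u'' z + \<beta> *\<^sub>R w'' z + 0) v > 0"
      using pos by (auto simp: u w intro: add_pos_nonneg add_nonneg_pos)
  qed
qed

text \<open>With \<open>\<theta>\<close> a smoothed positive part this is a regularized maximum of
  \<open>s\<close> and \<open>t\<close>. Its Levi form is the convex combination of theirs with
  weights \<open>1 - \<theta>'\<close> and \<open>\<theta>'\<close>, plus a nonnegative rank-one
  term from \<open>\<theta>''\<close>.\<close>

lemma spsh_on_glue:
  assumes s: "spsh_on S s" and t: "spsh_on S t"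
    and th: "\<And>x. (\<theta> has_real_derivative \<theta>' x) (at x)" "\<And>x. (\<theta>' has_real_derivative \<theta>'' x) (at x)"
      "continuous_on UNIV \<theta>''" "\<And>x. 0 \<le> \<theta>' x" "\<And>x. \<theta>' x \<le> 1" "\<And>x. 0 \<le> \<theta>'' x"
  shows "spsh_on S (\<lambda>z. s z + \<theta> (t z - s z))"
proof -
  obtain s' s'' where s: "C2_data S s s' s''" "\<And>z v. z \<in> S \<Longrightarrow> v \<noteq> 0 \<Longrightarrow> hermitian_part (s'' z) v > 0"
    using s unfolding spsh_on_def by blast
  obtain t' t'' where t: "C2_data S t t' t''" "\<And>z v. z \<in> S \<Longrightarrow> v \<noteq> 0 \<Longrightarrow> hermitian_part (t'' z) v > 0"
    using t unfolding spsh_on_def by blast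
  have "C2_data S (\<lambda>z. t z - s z) (\<lambda>z. t' z + (- 1) *\<^sub>R s' z) (\<lambda>z. t'' z + (- 1) *\<^sub>R s'' z)"
    using C2_data_add[OF t(1) C2_data_cmult[OF s(1), of "- 1"]] by simp
  note d = C2_data_add[OF s(1) C2_data_compose[OF this th(1-3)]]
  show ?thesis
    unfolding spsh_on_def
  proof (intro exI conjI ballI allI impI, rule d)
    fix z v :: "complex^'a" assume z: "z \<in> S" "v \<noteq> 0"
    let ?x = "t z - s z" and ?l = "t' z + (- 1) *\<^sub>R s' z"
    \<comment> \<open>Strictness comes from \<open>s\<close> where the weight of \<open>t\<close>
      vanishes, and from \<open>t\<close> elsewhere.\<close>
    have "0 < (1 - \<theta>' ?x) * hermitian_part (s'' z) v + \<theta>' ?x * hermitian_part (t'' z) v"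
    proof (cases "\<theta>' ?x = 0")
      case False
      then have "0 < \<theta>' ?x" using th(4)[of ?x] by simp
      then show ?thesis
        using s(2)[OF z] t(2)[OF z] th(5)[of ?x] by (intro add_nonneg_pos) auto
    qed (use s(2)[OF z] in simp)
    moreover have "0 \<le> \<theta>'' ?x * (((?l v)\<^sup>2 + (?l (\<i> *s v))\<^sup>2) / 4)"
      using th(6)[of ?x] by simp
    moreover have "p + (q + k * (r + (- 1) * p)) = ((1 - k) * p + k * r) + q" for p q k r :: real
      by (simp add: algebra_simps)
    ultimately show "hermitian_part (s'' z + (\<theta>'' ?x *\<^sub>R (blinfun_scaleR_left ?l o\<^sub>L ?l)
        + \<theta>' ?x *\<^sub>R (t'' z + (- 1) *\<^sub>R s'' z))) v > 0"
      unfolding hermitian_part_simps by (simp only: add_pos_nonneg)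
  qed
qed

lemma spsh_on_cong:
  assumes u: "spsh_on S u" and S: "open S" and eq: "\<And>z. z \<in> S \<Longrightarrow> u z = w z"
  shows "spsh_on S w"
proof -
  obtain u' u'' where d: "C2_data S u u' u''" "\<And>z v. z \<in> S \<Longrightarrow> v \<noteq> 0 \<Longrightarrow> hermitian_part (u'' z) v > 0"
    using u unfolding spsh_on_def by blast
  have "C2_data S w u' u''"
    unfolding C2_data_def
  proof (intro conjI ballI)
    fix z assume z: "z \<in> S"
    show "(w has_derivative u' z) (at z)"
      using C2_dataD(1)[OF d(1) z] S z eq by (rule has_derivative_transform_within_open)
  qed (use C2_dataD(2)[OF d(1)] C2_data_continuous_on(3)[OF d(1)] in auto)
  with d(2) show ?thesis unfolding spsh_on_def by blast
qed

text \<open>Derivatives are unique, so the two choices agree on the overlap. The first-order ones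
  are identified on this open set before the second-order ones are compared.\<close>

lemma spsh_on_Un:
  assumes S: "open S" "spsh_on S u" and T: "open T" "spsh_on T u"
  shows "spsh_on (S \<union> T) u"
proof -
  obtain s' s'' where s: "C2_data S u s' s''" "\<And>z v. z \<in> S \<Longrightarrow> v \<noteq> 0 \<Longrightarrow> hermitian_part (s'' z) v > 0"
    using S unfolding spsh_on_def by blast
  obtain t' t'' where t: "C2_data T u t' t''" "\<And>z v. z \<in> T \<Longrightarrow> v \<noteq> 0 \<Longrightarrow> hermitian_part (t'' z) v > 0"
    using T unfolding spsh_on_def by blast
  define u' where "u' z = (if z \<in> S then s' z else t' z)" for z
  define u'' where "u'' z = (if z \<in> S then s'' z else t'' z)" for z
  have 1: "s' z = t' z" if "z \<in> S" "z \<in> T" for z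
    using has_derivative_unique[OF C2_dataD(1)[OF s(1) that(1)] C2_dataD(1)[OF t(1) that(2)]]
    by (simp add: blinfun_apply_inject)
  have 2: "s'' z = t'' z" if z: "z \<in> S" "z \<in> T" for z
  proof -
    have "(s' has_derivative t'' z) (at z)"
      by (rule has_derivative_transform_within_open[OF C2_dataD(2)[OF t(1) z(2)] open_Int[OF S(1) T(1)]])
         (use z 1 in auto)
    from has_derivative_unique[OF C2_dataD(2)[OF s(1) z(1)] this] show ?thesis
      by (simp add: blinfun_apply_inject)
  qed
  have u'S: "u' z = s' z" "u'' z = s'' z" if "z \<in> S" for z using that by (auto simp: u'_def u''_def)
  have u'T: "u' z = t' z" "u'' z = t'' z" if "z \<in> T" for z using that 1 2 by (auto simp: u'_def u''_def)
  have "C2_data (S \<union> T) u u' u''"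
    unfolding C2_data_def
  proof (intro conjI ballI)
    fix z assume "z \<in> S \<union> T"
    then show "(u has_derivative u' z) (at z)"
      using C2_dataD(1)[OF s(1)] C2_dataD(1)[OF t(1)] u'S u'T by auto
  next
    fix z assume "z \<in> S \<union> T"
    then show "(u' has_derivative u'' z) (at z)"
    proof
      assume z: "z \<in> S"
      from has_derivative_transform_within_open[OF C2_dataD(2)[OF s(1) z] S(1) z, of u'] show ?thesis
        using u'S z by simp
    next
      assume z: "z \<in> T"
      from has_derivative_transform_within_open[OF C2_dataD(2)[OF t(1) z] T(1) z, of u'] show ?thesis
        using u'T z by simp
    qed
  next
    have "continuous_on S u''" "continuous_on T u''"
      using C2_data_continuous_on(3)[OF s(1)] C2_data_continuous_on(3)[OF t(1)] u'S u'T
      by (auto cong: continuous_on_cong)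
    then show "continuous_on (S \<union> T) u''"
      by (rule continuous_on_open_Un[OF S(1) T(1)])
  qed
  then show ?thesis
    unfolding spsh_on_def using s(2) t(2) u'S u'T by (intro exI conjI) auto
qed

section \<open>Coordinates on the projective plane\<close>

lemma cp2_point_eq_iff:
  assumes "v \<noteq> 0" "w \<noteq> 0"
  shows "cp2_point v = cp2_point w \<longleftrightarrow> (\<exists>c. c \<noteq> 0 \<and> w = c *s v)"
proof -
  have "proj_rel v v" "proj_rel w w"
    using assms by (auto simp: proj_rel_def intro!: exI[of _ 1])
  then have "cp2_point v = cp2_point w \<longleftrightarrow> proj_rel v w"
    using Quotient3_rel[OF Quotient3_cp2, of v w] by blast
  with assms show ?thesis by (simp add: proj_rel_def)
qed

lemma cp2_point_cases:
  obtains v where "v \<noteq> 0" "p = cp2_point v"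
  using Quotient3_abs_rep[OF Quotient3_cp2, of p] Quotient3_rep_reflp[OF Quotient3_cp2, of p]
  by (metis proj_rel_def)

lemma vector3_nth [simp]:
  "(vector [x, y, z] :: complex^3) $ 1 = x" "(vector [x, y, z] :: complex^3) $ 2 = y"
  "(vector [x, y, z] :: complex^3) $ 3 = z"
  by (simp_all add: vector_3)

lemma vector2_nth [simp]:
  "(vector [x, y] :: complex^2) $ 1 = x" "(vector [x, y] :: complex^2) $ 2 = y"
  by (simp_all add: vector_2)

lemma vec3_eq_iff: "(v :: complex^3) = w \<longleftrightarrow> v $ 1 = w $ 1 \<and> v $ 2 = w $ 2 \<and> v $ 3 = w $ 3"
  by (auto simp: vec_eq_iff forall_3)

lemma vec2_eq_iff: "(v :: complex^2) = w \<longleftrightarrow> v $ 1 = w $ 1 \<and> v $ 2 = w $ 2"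
  by (auto simp: vec_eq_iff forall_2)

lemma affine_param_simps:
  "affine_param 1 w = cp2_point (vector [1, w $ 1, w $ 2])"
  "affine_param 2 w = cp2_point (vector [w $ 1, 1, w $ 2])"
  "affine_param 3 w = cp2_point (vector [w $ 1, w $ 2, 1])"
  by (simp_all add: affine_param_def)

lemma vector3_nonzero [simp]:
  "(vector [1, y, z] :: complex^3) \<noteq> 0" "(vector [x, 1, z] :: complex^3) \<noteq> 0"
  "(vector [x, y, 1] :: complex^3) \<noteq> 0"
  by (simp_all add: vec3_eq_iff)

lemma inj_affine_param: "inj (affine_param i)"
proof (rule injI)
  fix v w assume *: "affine_param i v = affine_param i w"
  consider "i = 1" | "i = 2" | "i = 3" using exhaust_3 by blast
  then show "v = w"
    using * by cases (auto simp: affine_param_simps cp2_point_eq_iff vec3_eq_iff vec2_eq_iff)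
qed

lemma affine_param_cp2_point:
  assumes "v $ i \<noteq> 0"
  shows "affine_param i (if i = 1 then vector [v $ 2 / v $ 1, v $ 3 / v $ 1]
     else if i = 2 then vector [v $ 1 / v $ 2, v $ 3 / v $ 2]
     else vector [v $ 1 / v $ 3, v $ 2 / v $ 3]) = cp2_point v"
proof -
  have "v \<noteq> 0" using assms by auto
  consider "i = 1" | "i = 2" | "i = 3" using exhaust_3 by blast
  then show ?thesis
    using assms \<open>v \<noteq> 0\<close>
    by cases (auto simp: affine_param_simps cp2_point_eq_iff vec3_eq_iff intro!: exI[of _ "v $ i"])
qed

lemma inv_affine_param_cp2_point:
  assumes "v $ i \<noteq> 0"
  shows "inv (affine_param i) (cp2_point v) = (if i = 1 then vector [v $ 2 / v $ 1, v $ 3 / v $ 1]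
     else if i = 2 then vector [v $ 1 / v $ 2, v $ 3 / v $ 2]
     else vector [v $ 1 / v $ 3, v $ 2 / v $ 3])"
  by (rule inv_f_eq[OF inj_affine_param affine_param_cp2_point[OF assms]])

lemma cp2_point_in_range: "v $ i \<noteq> 0 \<Longrightarrow> cp2_point v \<in> range (affine_param i)"
  by (metis affine_param_cp2_point rangeI)

text \<open>A homogeneous condition does not depend on the representative. The assumption
  \<open>\<not> Q 0\<close> keeps out the meaningless \<open>cp2_point 0\<close>.\<close>

lemma cp2_point_mem_image:
  assumes hom: "\<And>c v. c \<noteq> 0 \<Longrightarrow> Q v \<Longrightarrow> Q (c *s v)" and "\<not> Q 0" "v \<noteq> 0"
  shows "cp2_point v \<in> cp2_point ` Collect Q \<longleftrightarrow> Q v"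
proof
  assume "cp2_point v \<in> cp2_point ` Collect Q"
  then obtain w where w: "cp2_point w = cp2_point v" "Q w" by auto
  with assms have "w \<noteq> 0" by auto
  with w assms show "Q v" by (auto simp: cp2_point_eq_iff)
qed auto

lemma open_cp2_image:
  assumes hom: "\<And>c v. c \<noteq> 0 \<Longrightarrow> Q v \<Longrightarrow> Q (c *s v)" and Q0: "\<not> Q 0" and op: "open (Collect Q)"
  shows "open (cp2_point ` Collect Q)"
proof -
  have "{v. v \<noteq> 0 \<and> cp2_point v \<in> cp2_point ` Collect Q} = Collect Q"
    using cp2_point_mem_image[of Q, OF hom Q0] Q0 by (auto simp del: image_iff)
  with op show ?thesis by (simp add: open_cp2_def)
qed

lemma vector_eq_axis:
  "(vector [x, y] :: complex^2) = axis 1 x + axis 2 y"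
  "(vector [x, y, z] :: complex^3) = axis 1 x + axis 2 y + axis 3 z"
  by (simp_all add: vec2_eq_iff vec3_eq_iff axis_def)

text \<open>Openness in the quotient is openness of the preimage in homogeneous coordinates, and the
  chart lifts to the continuous map \<open>q\<close>.\<close>

lemma continuous_on_affine_param: "continuous_on S (affine_param i)"
proof (rule continuous_on_subset[of UNIV], unfold continuous_on_open_vimage[OF open_UNIV], safe)
  fix B :: "cp2 set" assume "open B"
  then have op: "open {v. v \<noteq> 0 \<and> cp2_point v \<in> B}" by (simp add: open_cp2_def)
  define q :: "complex^2 \<Rightarrow> complex^3" where "q z = (if i = 1 then vector [1, z $ 1, z $ 2]
      else if i = 2 then vector [z $ 1, 1, z $ 2] else vector [z $ 1, z $ 2, 1])" for z
  have "continuous_on UNIV q"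
    unfolding q_def vector_eq_axis by (cases "i = 1"; cases "i = 2"; simp; intro continuous_intros)
  then have "open (q -` {v. v \<noteq> 0 \<and> cp2_point v \<in> B})"
    using op unfolding continuous_on_open_vimage[OF open_UNIV] Int_UNIV_right by blast
  also have "q -` {v. v \<noteq> 0 \<and> cp2_point v \<in> B} = affine_param i -` B \<inter> UNIV"
    by (auto simp: q_def affine_param_def)
  finally show "open (affine_param i -` B \<inter> UNIV)" .
qed simp

text \<open>Outside \<open>range (affine_param i)\<close> the value is arbitrary, as
  \<open>inv\<close> is total.\<close>

definition affine_coord :: "3 \<Rightarrow> cp2 \<Rightarrow> complex^2" where
  "affine_coord i = inv (affine_param i)"

text \<open>The image is the preimage of \<open>W\<close> under the inverse chart, which is
  continuous on an open set.\<close>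

lemma open_chart_image:
  assumes "holo_coords U \<phi>" "open W"
  shows "open (\<phi> ` (U \<inter> W))"
proof -
  have "inj_on \<phi> U" and open_img: "open (\<phi> ` U)" and cont: "continuous_on (\<phi> ` U) (inv_into U \<phi>)"
    using assms by (auto simp: holo_coords_def homeomorphism_def)
  then have "\<phi> ` (U \<inter> W) = \<phi> ` U \<inter> inv_into U \<phi> -` W" by auto
  then show ?thesis
    using continuous_open_preimage[OF cont open_img assms(2)] by simp
qed

text \<open>The last condition says that the two differentials are linearly independent.\<close>

lemma holo_coords_affine:
  assumes "holo_coords U \<phi>" and D: "D = \<phi> ` (U \<inter> range (affine_param i))" and open_range: "open (range (affine_param i))"
  obtains a b where
    "\<And>z. z \<in> D \<Longrightarrow> ((\<lambda>z. affine_coord i (inv_into U \<phi> z) $ 1) has_derivative cform (a z)) (at z)"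
    "\<And>z. z \<in> D \<Longrightarrow> ((\<lambda>z. affine_coord i (inv_into U \<phi> z) $ 2) has_derivative cform (b z)) (at z)"
    "\<And>z v. z \<in> D \<Longrightarrow> cform (a z) v = 0 \<Longrightarrow> cform (b z) v = 0 \<Longrightarrow> v = 0"
proof -
  define g where "g z = affine_coord i (inv_into U \<phi> z)" for z
  have inj: "inj_on \<phi> U" and holo: "holo_map_on (affine_param i -` U) (\<phi> \<circ> affine_param i)"
    and "holo_map_on D (inv (affine_param i) \<circ> inv_into U \<phi>)"
    using assms by (auto simp: holo_coords_def)
  then have "holo_fun_on D (\<lambda>z. g z $ k)" for k
    by (simp add: holo_map_on_def g_def affine_coord_def)
  then obtain a b where ab: "\<And>z. z \<in> D \<Longrightarrow> ((\<lambda>z. g z $ 1) has_derivative cform (a z)) (at z)"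
    "\<And>z. z \<in> D \<Longrightarrow> ((\<lambda>z. g z $ 2) has_derivative cform (b z)) (at z)"
    by (metis holo_fun_onD)
  have gD: "affine_param i (g z) \<in> U" "\<phi> (affine_param i (g z)) = z" if "z \<in> D" for z
    using that inj unfolding D g_def affine_coord_def
    by (auto simp: f_inv_into_f)
  have "open D" unfolding D by (rule open_chart_image[OF assms(1) open_range])
  \<comment> \<open>Differentiating \<open>\<phi> (affine_param i (g z)) = z\<close> expresses each
    coordinate of \<open>v\<close> through the two differentials applied to \<open>v\<close>, and
    these vanish.\<close>
  have "v = 0" if z: "z \<in> D" and v: "cform (a z) v = 0" "cform (b z) v = 0" for z v
  proof (rule vec_eq_iff[THEN iffD2], rule)
    fix k
    have "g z \<in> affine_param i -` U" using gD z by simp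
    with holo obtain c where c: "((\<lambda>w. \<phi> (affine_param i w) $ k) has_derivative cform c) (at (g z))"
      unfolding holo_map_on_def o_def by (metis holo_fun_onD)
    have "((\<lambda>z. axis 1 (g z $ 1) + axis 2 (g z $ 2) :: complex^2) has_derivative (\<lambda>v. axis 1 (cform (a z) v) + axis 2 (cform (b z) v))) (at z)"
      by (intro has_derivative_add bounded_linear.has_derivative[OF bounded_linear_axis] ab z)
    moreover have "(\<lambda>z. axis 1 (g z $ 1) + axis 2 (g z $ 2)) = g"
      by (simp add: fun_eq_iff vec2_eq_iff axis_def)
    ultimately have "(g has_derivative (\<lambda>v. axis 1 (cform (a z) v) + axis 2 (cform (b z) v))) (at z)"
      by simp
    from diff_chain_at[OF this c]
    have "((\<lambda>z. \<phi> (affine_param i (g z)) $ k) has_derivative (\<lambda>v. cform c (axis 1 (cform (a z) v) + axis 2 (cform (b z) v)))) (at z)"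
      by (simp add: o_def)
    then have "((\<lambda>z. z $ k) has_derivative (\<lambda>v. cform c (axis 1 (cform (a z) v) + axis 2 (cform (b z) v)))) (at z)"
      by (rule has_derivative_transform_within_open[OF _ \<open>open D\<close> z]) (use gD in simp)
    moreover have "((\<lambda>z. z $ k) has_derivative (\<lambda>v. v $ k)) (at z)"
      by (intro bounded_linear.has_derivative[OF bounded_linear_vec_nth] has_derivative_ident)
    ultimately have "(\<lambda>v. v $ k) = (\<lambda>v. cform c (axis 1 (cform (a z) v) + axis 2 (cform (b z) v)))"
      using has_derivative_unique by blast
    from fun_cong[OF this, of v] v show "v $ k = (0 :: complex^2) $ k"
      by (simp add: blinfun.bilinear_simps)
  qed
  with ab that show ?thesis unfolding g_def by blast
qed

section \<open>The domain and its strongly plurisubharmonic function\<close>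

lemma DERIV_max_0_power:
  assumes "n > 0"
  shows "((\<lambda>x. max 0 x ^ Suc n) has_real_derivative real (Suc n) * max 0 x ^ n) (at x)"
proof -
  consider "x > 0" | "x < 0" | "x = 0" by linarith
  then show ?thesis
  proof cases
    case 1
    have "((\<lambda>x. x ^ Suc n) has_real_derivative real (Suc n) * x ^ n) (at x)"
      by (rule derivative_eq_intros refl)+ simp
    then have "((\<lambda>x. max 0 x ^ Suc n) has_real_derivative real (Suc n) * x ^ n) (at x)"
      by (rule has_field_derivative_transform_within_open[where S = "{0<..}"]) (use 1 in \<open>auto simp: max_def\<close>)
    with 1 show ?thesis by simp
  next
    case 2
    have "((\<lambda>x. 0 :: real) has_real_derivative 0) (at x)" by simp
    then have "((\<lambda>x. max 0 x ^ Suc n) has_real_derivative 0) (at x)"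
      by (rule has_field_derivative_transform_within_open[where S = "{..<0}"]) (use 2 in \<open>auto simp: max_def\<close>)
    moreover have "real (Suc n) * max 0 x ^ n = 0" using 2 assms by simp
    ultimately show ?thesis by (simp only:)
  next
    case 3
    \<comment> \<open>At \<open>h = 0\<close> both sides are 0, since division by 0 gives 0 and
      \<open>n\<close> is positive. The right side tends to 0, so there is no corner at the
      origin.\<close>
    have "(\<lambda>h. max 0 h ^ Suc n / h) = (\<lambda>h::real. max 0 h ^ n)"
      using assms by (auto simp: fun_eq_iff max_def)
    moreover have "((\<lambda>h::real. max 0 h ^ n) \<longlongrightarrow> max 0 0 ^ n) (at 0)"
      by (intro tendsto_intros)
    ultimately show ?thesis
      using assms 3 by (simp add: DERIV_def zero_power)
  qed
qed

text \<open>A \<open>C\<^sup>2\<close> spline: its second derivative is the hat function supported on \<open>[-1, 1]\<close>, so it is a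
  convex function interpolating between \<open>0\<close> and the identity.\<close>

definition soft_pos :: "real \<Rightarrow> real" where
  "soft_pos x = (max 0 (x + 1) ^ 3 - 2 * max 0 x ^ 3 + max 0 (x - 1) ^ 3) / 6"

definition soft_pos' :: "real \<Rightarrow> real" where
  "soft_pos' x = (max 0 (x + 1) ^ 2 - 2 * max 0 x ^ 2 + max 0 (x - 1) ^ 2) / 2"

definition soft_pos'' :: "real \<Rightarrow> real" where
  "soft_pos'' x = max 0 (x + 1) - 2 * max 0 x + max 0 (x - 1)"

lemma DERIV_soft_pos:
  "(soft_pos has_real_derivative soft_pos' x) (at x)"
  "(soft_pos' has_real_derivative soft_pos'' x) (at x)"
proof -
  have shift: "((\<lambda>x. x + c) has_real_derivative 1) (at x)" for c :: real
    by (auto intro!: derivative_eq_intros)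
  have 2: "((\<lambda>x. max 0 (x + c) ^ 2) has_real_derivative 2 * max 0 (x + c)) (at x)" for c :: real
    using DERIV_chain2[OF DERIV_max_0_power[of 1 "x + c"] shift] by (simp add: numeral_2_eq_2 del: power_Suc)
  have 3: "((\<lambda>x. max 0 (x + c) ^ 3) has_real_derivative 3 * max 0 (x + c) ^ 2) (at x)" for c :: real
    using DERIV_chain2[OF DERIV_max_0_power[of 2 "x + c"] shift] by (simp del: power_Suc)
  show "(soft_pos has_real_derivative soft_pos' x) (at x)"
    using DERIV_cdivide[OF DERIV_add[OF DERIV_diff[OF 3[of 1] DERIV_cmult[OF 3[of 0], of 2]] 3[of "-1"]], of 6]
    by (simp add: soft_pos_def[abs_def] soft_pos'_def DERIV_cong field_simps)
  show "(soft_pos' has_real_derivative soft_pos'' x) (at x)"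
    using DERIV_cdivide[OF DERIV_add[OF DERIV_diff[OF 2[of 1] DERIV_cmult[OF 2[of 0], of 2]] 2[of "-1"]], of 2]
    by (simp add: soft_pos'_def[abs_def] soft_pos''_def DERIV_cong field_simps)
qed

lemma continuous_on_soft_pos'': "continuous_on S soft_pos''"
  unfolding soft_pos''_def[abs_def] by (intro continuous_intros)

text \<open>To the left of -1 all three cubics are cut off. To the right of 1 none is, and the
  second difference of \<open>x ^ 3\<close> is \<open>6 * x\<close>.\<close>

lemma soft_pos_eq:
  "x \<le> -1 \<Longrightarrow> soft_pos x = 0" "x \<ge> 1 \<Longrightarrow> soft_pos x = x"
  by (auto simp: soft_pos_def max_def power3_eq_cube field_simps)

lemma soft_pos''_nonneg: "0 \<le> soft_pos'' x"
  by (auto simp: soft_pos''_def max_def)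

lemma soft_pos'_mono: "x \<le> y \<Longrightarrow> soft_pos' x \<le> soft_pos' y"
  by (rule DERIV_nonneg_imp_nondecreasing) (use DERIV_soft_pos soft_pos''_nonneg in blast)+

lemma soft_pos'_bounds: "0 \<le> soft_pos' x" "soft_pos' x \<le> 1"
proof -
  \<comment> \<open>The monotone \<open>soft_pos'\<close> is 0 up to -1 and 1 from 1 on;
    \<open>min\<close> and \<open>max\<close> give comparison points on either side of
    \<open>x\<close> in these ranges.\<close>
  have "soft_pos' (min x (-1)) = 0" "soft_pos' (max x 1) = 1"
    by (auto simp: soft_pos'_def max_def min_def power2_eq_square field_simps)
  then show "0 \<le> soft_pos' x" "soft_pos' x \<le> 1"
    using soft_pos'_mono[of "min x (-1)" x] soft_pos'_mono[of x "max x 1"] by simp_all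
qed

text \<open>In each image below the inequalities force \<open>v \<noteq> 0\<close>.\<close>

definition inner_piece :: "cp2 set" where
  "inner_piece = cp2_point ` {v. cmod (v $ 2) < cmod (v $ 3)}"

text \<open>The bound \<open>11 / 5\<close> exceeds 2, so the bridge overlaps both tubes. The
  annulus is narrow enough for the estimates in \<open>rho_gap\<close>.\<close>

definition bridge :: "cp2 set" where
  "bridge = cp2_point ` {v. cmod (v $ 3) < cmod (v $ 1) \<and> 4 * cmod (v $ 1) < 5 * cmod (v $ 3) \<and>
     5 * cmod (v $ 2) < 11 * cmod (v $ 3)}"

definition outer_piece :: "cp2 set" where
  "outer_piece = cp2_point ` {v. v $ 1 \<noteq> 0 \<and> 2 * cmod (v $ 3) < cmod (v $ 2)}"

definition thin_domain :: "cp2 set" where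
  "thin_domain = inner_piece \<union> bridge \<union> outer_piece"

lemma cp2_point_mem:
  assumes "v \<noteq> 0"
  shows "cp2_point v \<in> inner_piece \<longleftrightarrow> cmod (v $ 2) < cmod (v $ 3)"
    and "cp2_point v \<in> bridge \<longleftrightarrow> cmod (v $ 3) < cmod (v $ 1) \<and> 4 * cmod (v $ 1) < 5 * cmod (v $ 3) \<and>
       5 * cmod (v $ 2) < 11 * cmod (v $ 3)"
    and "cp2_point v \<in> outer_piece \<longleftrightarrow> v $ 1 \<noteq> 0 \<and> 2 * cmod (v $ 3) < cmod (v $ 2)"
  unfolding inner_piece_def bridge_def outer_piece_def
  by (subst cp2_point_mem_image; use assms in \<open>auto simp: norm_mult\<close>)+

lemma open_pieces: "open inner_piece" "open bridge" "open outer_piece"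
  unfolding inner_piece_def bridge_def outer_piece_def
  by (rule open_cp2_image; auto simp: norm_mult intro!: open_Collect_conj open_Collect_less open_Collect_neq continuous_intros)+

lemma open_range_affine_param: "open (range (affine_param i))"
proof -
  have "range (affine_param i) = cp2_point ` {v. v $ i \<noteq> 0}"
  proof safe
    fix w
    consider "i = 1" | "i = 2" | "i = 3" using exhaust_3 by blast
    then show "affine_param i w \<in> cp2_point ` {v. v $ i \<noteq> 0}"
      by cases (auto simp: affine_param_simps intro!: imageI)
  qed (rule cp2_point_in_range)
  moreover have "open (cp2_point ` {v. v $ i \<noteq> 0})"
    by (rule open_cp2_image) (auto intro!: open_Collect_neq continuous_intros)
  ultimately show ?thesis by simp
qed

definition affine_quadratic :: "3 \<Rightarrow> real \<Rightarrow> real \<Rightarrow> real \<Rightarrow> cp2 \<Rightarrow> real" where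
  "affine_quadratic i \<alpha> \<beta> \<gamma> p =
     \<alpha> * (cmod (affine_coord i p $ 1))\<^sup>2 + \<beta> * (cmod (affine_coord i p $ 2))\<^sup>2 + \<gamma>"

abbreviation rho_inner :: "cp2 \<Rightarrow> real" where
  "rho_inner \<equiv> affine_quadratic 3 1 1 0"

text \<open>The constants make this smaller than \<open>rho_inner\<close> on the bridge where \<open>\<bar>y\<bar> \<le> \<bar>z\<bar>\<close>
  and larger where \<open>\<bar>y\<bar> \<ge> 2 \<bar>z\<bar>\<close>, with gap at least \<open>1\<close>.\<close>

abbreviation rho_outer :: "cp2 \<Rightarrow> real" where
  "rho_outer \<equiv> affine_quadratic 1 9 1 (- 10)"

definition rho :: "cp2 \<Rightarrow> real" where
  "rho p = (if p \<in> inner_piece then rho_inner p else if p \<in> outer_piece then rho_outer p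
     else rho_inner p + soft_pos (rho_outer p - rho_inner p))"

lemma rho_gap:
  fixes x y z :: real
  assumes "0 < z" "0 \<le> y" "z < x" "4 * x < 5 * z" "5 * y < 11 * z"
  shows "y \<le> z \<Longrightarrow> 9 * (y / x)\<^sup>2 + (z / x)\<^sup>2 - 10 - ((x / z)\<^sup>2 + (y / z)\<^sup>2) \<le> - 1"
    and "2 * z \<le> y \<Longrightarrow> 9 * (y / x)\<^sup>2 + (z / x)\<^sup>2 - 10 - ((x / z)\<^sup>2 + (y / z)\<^sup>2) \<ge> 1"
proof -
  have "1 \<le> x / z" "x / z \<le> 5 / 4" "y / z \<le> 11 / 5" "0 \<le> y / z" "0 \<le> z / x" "z / x \<le> 1"
    using assms by (simp_all add: field_simps)
  then have 1: "1\<^sup>2 \<le> (x / z)\<^sup>2" "(x / z)\<^sup>2 \<le> (5 / 4)\<^sup>2" "(y / z)\<^sup>2 \<le> (11 / 5)\<^sup>2"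
    "0 \<le> (z / x)\<^sup>2" "(z / x)\<^sup>2 \<le> 1\<^sup>2"
    by (auto intro!: power_mono power_le_one simp del: one_power2)
  {
    assume "y \<le> z"
    then have "y / x \<le> 1" "0 \<le> y / x" using assms by (simp_all add: field_simps)
    then have "(y / x)\<^sup>2 \<le> 1" by (simp add: power_le_one)
    moreover have "(y / z)\<^sup>2 \<ge> 0" by simp
    \<comment> \<open>The bounds add up to \<open>9 + 1 - 10 - 1 = - 1\<close>, without
      slack.\<close>
    ultimately show "9 * (y / x)\<^sup>2 + (z / x)\<^sup>2 - 10 - ((x / z)\<^sup>2 + (y / z)\<^sup>2) \<le> - 1"
      using 1 unfolding one_power2 by linarith
  next
    assume "2 * z \<le> y"
    \<comment> \<open>The value \<open>8 / 5\<close> is 2 divided by \<open>5 / 4\<close>. It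
      suffices because \<open>9 * 64 / 25 - 10 - 25 / 16 - 121 / 25\<close> is above 6.\<close>
    then have "8 / 5 \<le> y / x" using assms by (simp add: field_simps)
    then have "(8 / 5)\<^sup>2 \<le> (y / x)\<^sup>2" by (intro power_mono) auto
    moreover have squares: "(5 / 4 :: real)\<^sup>2 = 25 / 16" "(11 / 5 :: real)\<^sup>2 = 121 / 25" "(8 / 5 :: real)\<^sup>2 = 64 / 25"
      by (simp_all add: power2_eq_square)
    ultimately show "9 * (y / x)\<^sup>2 + (z / x)\<^sup>2 - 10 - ((x / z)\<^sup>2 + (y / z)\<^sup>2) \<ge> 1"
      using 1 \<open>(8 / 5)\<^sup>2 \<le> (y / x)\<^sup>2\<close> squares by linarith
  }
qed

text \<open>The tubes are disjoint, and where the bridge meets one of them the gap puts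
  \<open>soft_pos\<close> in the range where it is 0 or the identity. Hence each open piece carries
  a single formula, and plurisubharmonicity can be checked piece by piece.\<close>

lemma rho_eq:
  shows "p \<in> inner_piece \<Longrightarrow> rho p = rho_inner p"
    and "p \<in> outer_piece \<Longrightarrow> rho p = rho_outer p"
    and "p \<in> bridge \<Longrightarrow> rho p = rho_inner p + soft_pos (rho_outer p - rho_inner p)"
proof -
  obtain v where v: "v \<noteq> 0" "p = cp2_point v" by (rule cp2_point_cases)
  note mem = cp2_point_mem[OF v(1), folded v(2)]
  show "p \<in> inner_piece \<Longrightarrow> rho p = rho_inner p" by (simp add: rho_def)
  show "p \<in> outer_piece \<Longrightarrow> rho p = rho_outer p"
    using mem(1,3) norm_ge_zero[of "v $ 3"] by (auto simp: rho_def simp del: norm_ge_zero)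
  assume p: "p \<in> bridge"
  then have nz: "v $ 1 \<noteq> 0" "v $ 3 \<noteq> 0" using mem(2) by auto
  have gap: "rho_outer p - rho_inner p = 9 * (cmod (v $ 2) / cmod (v $ 1))\<^sup>2 + (cmod (v $ 3) / cmod (v $ 1))\<^sup>2 - 10
     - ((cmod (v $ 1) / cmod (v $ 3))\<^sup>2 + (cmod (v $ 2) / cmod (v $ 3))\<^sup>2)"
    using nz by (simp add: affine_quadratic_def affine_coord_def v(2) inv_affine_param_cp2_point norm_divide)
  note g = rho_gap[of "cmod (v $ 3)" "cmod (v $ 2)" "cmod (v $ 1)", folded gap]
  show "rho p = rho_inner p + soft_pos (rho_outer p - rho_inner p)"
  proof (cases "p \<in> inner_piece")
    case True
    then have "rho_outer p - rho_inner p \<le> - 1"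
      using p nz mem(1,2) by (intro g(1)) auto
    with True show ?thesis by (simp add: rho_def soft_pos_eq)
  next
    case False
    show ?thesis
    proof (cases "p \<in> outer_piece")
      case far: True
      then have "rho_outer p - rho_inner p \<ge> 1"
        using p nz mem(2,3) by (intro g(2)) auto
      with False far show ?thesis by (simp add: rho_def soft_pos_eq)
    qed (use False in \<open>simp add: rho_def\<close>)
  qed
qed

text \<open>The bridge lies in two charts, as \<open>x\<close> and \<open>z\<close> do not vanish
  there, so both quadratics are available for blending.\<close>

lemma pieces_in_charts:
  "inner_piece \<subseteq> range (affine_param 3)" "bridge \<subseteq> range (affine_param 3)"
  "bridge \<subseteq> range (affine_param 1)" "outer_piece \<subseteq> range (affine_param 1)"
  unfolding inner_piece_def bridge_def outer_piece_def by (auto intro!: cp2_point_in_range)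

text \<open>In any holomorphic chart the affine coordinates are holomorphic with independent
  differentials, so positivity does not depend on the chart.\<close>

lemma spsh_on_affine_quadratic:
  assumes coords: "holo_coords U \<phi>" and W: "open W" "W \<subseteq> range (affine_param i)" and "\<alpha> > 0" "\<beta> > 0"
  shows "spsh_on (\<phi> ` (U \<inter> W)) (\<lambda>z. affine_quadratic i \<alpha> \<beta> \<gamma> (inv_into U \<phi> z))"
proof -
  obtain a b where ab: "\<And>z. z \<in> \<phi> ` (U \<inter> range (affine_param i)) \<Longrightarrow> ((\<lambda>z. affine_coord i (inv_into U \<phi> z) $ 1) has_derivative cform (a z)) (at z)"
    "\<And>z. z \<in> \<phi> ` (U \<inter> range (affine_param i)) \<Longrightarrow> ((\<lambda>z. affine_coord i (inv_into U \<phi> z) $ 2) has_derivative cform (b z)) (at z)"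
    "\<And>z v. z \<in> \<phi> ` (U \<inter> range (affine_param i)) \<Longrightarrow> cform (a z) v = 0 \<Longrightarrow> cform (b z) v = 0 \<Longrightarrow> v = 0"
    using holo_coords_affine[OF coords refl open_range_affine_param] by blast
  have sub: "z \<in> \<phi> ` (U \<inter> W) \<Longrightarrow> z \<in> \<phi> ` (U \<inter> range (affine_param i))" for z using W by auto
  show ?thesis
    unfolding affine_quadratic_def
    by (rule spsh_on_norm_holo_sum[where a = a and b = b, OF ab(1)[OF sub] ab(2)[OF sub]
          open_chart_image[OF coords W(1)] assms(4,5) ab(3)[OF sub]])
qed

lemma strongly_psh_on_rho: "strongly_psh_on thin_domain rho"
proof -
  have "spsh_on (\<phi> ` (U \<inter> thin_domain)) (rho \<circ> inv_into U \<phi>)" "open (\<phi> ` (U \<inter> thin_domain))"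
    if coords: "holo_coords U \<phi>" for U \<phi>
  proof -
    have inv: "inv_into U \<phi> z \<in> W" if "z \<in> \<phi> ` (U \<inter> W)" for z W
      using that coords by (auto simp: holo_coords_def)
    note op = open_chart_image[OF coords open_pieces(1)] open_chart_image[OF coords open_pieces(2)]
      open_chart_image[OF coords open_pieces(3)]
    have near: "spsh_on (\<phi> ` (U \<inter> W)) (\<lambda>z. rho_inner (inv_into U \<phi> z))"
      if "open W" "W \<subseteq> range (affine_param 3)" for W
      by (rule spsh_on_affine_quadratic[OF coords that]) auto
    have far: "spsh_on (\<phi> ` (U \<inter> W)) (\<lambda>z. rho_outer (inv_into U \<phi> z))"
      if "open W" "W \<subseteq> range (affine_param 1)" for W
      by (rule spsh_on_affine_quadratic[OF coords that]) auto
    have "spsh_on (\<phi> ` (U \<inter> inner_piece)) (rho \<circ> inv_into U \<phi>)"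
      by (rule spsh_on_cong[OF near[OF open_pieces(1) pieces_in_charts(1)] op(1)])
         (simp add: rho_eq(1) inv)
    moreover have "spsh_on (\<phi> ` (U \<inter> bridge)) (rho \<circ> inv_into U \<phi>)"
      by (rule spsh_on_cong[OF spsh_on_glue[OF near[OF open_pieces(2) pieces_in_charts(2)]
            far[OF open_pieces(2) pieces_in_charts(3)] DERIV_soft_pos continuous_on_soft_pos'' soft_pos'_bounds soft_pos''_nonneg] op(2)])
         (simp add: rho_eq(3) inv)
    moreover have "spsh_on (\<phi> ` (U \<inter> outer_piece)) (rho \<circ> inv_into U \<phi>)"
      by (rule spsh_on_cong[OF far[OF open_pieces(3) pieces_in_charts(4)] op(3)])
         (simp add: rho_eq(2) inv)
    moreover have "\<phi> ` (U \<inter> thin_domain) = \<phi> ` (U \<inter> inner_piece) \<union> \<phi> ` (U \<inter> bridge) \<union> \<phi> ` (U \<inter> outer_piece)"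
      by (auto simp: thin_domain_def)
    ultimately show "spsh_on (\<phi> ` (U \<inter> thin_domain)) (rho \<circ> inv_into U \<phi>)" "open (\<phi> ` (U \<inter> thin_domain))"
      using op by (auto intro!: spsh_on_Un)
  qed
  then show ?thesis
    unfolding strongly_psh_on_def by (auto intro!: spsh_on_levi)
qed

section \<open>Holomorphic functions on the domain are constant\<close>

lemma holo_fun_on_slice:
  fixes f :: "complex^2 \<Rightarrow> complex"
  assumes "holo_fun_on S f"
  shows "\<And>T. (\<And>x. x \<in> T \<Longrightarrow> vector [x, y] \<in> S) \<Longrightarrow> (\<lambda>x. f (vector [x, y])) holomorphic_on T"
    and "\<And>T. (\<And>y. y \<in> T \<Longrightarrow> vector [x, y] \<in> S) \<Longrightarrow> (\<lambda>y. f (vector [x, y])) holomorphic_on T"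
proof -
  obtain a where a: "\<And>z. z \<in> S \<Longrightarrow> (f has_derivative cform (a z)) (at z)"
    using assms by (metis holo_fun_onD)
  show "(\<lambda>x. f (vector [x, y])) holomorphic_on T" if "\<And>x. x \<in> T \<Longrightarrow> vector [x, y] \<in> S" for T
  proof -
    have "((\<lambda>w. f (axis 2 y + axis 1 w)) has_field_derivative a (axis 2 y + axis 1 x) $ 1) (at x)" if "x \<in> T" for x
      by (rule cform_line, rule a) (use that \<open>\<And>x. x \<in> T \<Longrightarrow> vector [x, y] \<in> S\<close> in \<open>simp add: vector_eq_axis add.commute\<close>)
    then show ?thesis
      unfolding vector_eq_axis add.commute[of "axis 1 _"]
      by (meson field_differentiable_at_within field_differentiable_def holomorphic_onI)
  qed
  show "(\<lambda>y. f (vector [x, y])) holomorphic_on T" if "\<And>y. y \<in> T \<Longrightarrow> vector [x, y] \<in> S" for T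
  proof -
    have "((\<lambda>w. f (axis 1 x + axis 2 w)) has_field_derivative a (axis 1 x + axis 2 y) $ 2) (at y)" if "y \<in> T" for y
      by (rule cform_line, rule a) (use that \<open>\<And>y. y \<in> T \<Longrightarrow> vector [x, y] \<in> S\<close> in \<open>simp add: vector_eq_axis\<close>)
    then show ?thesis
      unfolding vector_eq_axis
      by (meson field_differentiable_at_within field_differentiable_def holomorphic_onI)
  qed
qed

lemma continuous_on_vector2:
  assumes "continuous_on A f" "continuous_on A g"
  shows "continuous_on A (\<lambda>x. vector [f x, g x] :: complex^2)"
  unfolding vector_eq_axis by (intro continuous_intros assms)

text \<open>Differentiation under the integral, with a partial derivative that is continuous by
  \<open>partial_holo\<close>. By \<open>sub\<close> the set \<open>S\<close> contains the circle
  times the whole \<open>y\<close>-plane, which makes the result entire.\<close>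

lemma integral_holo_slices:
  fixes f :: "complex^2 \<Rightarrow> complex"
  assumes f: "holo_fun_on S f" and S: "open S" and sub: "\<And>t y. vector [u * unit_circle t, y] \<in> S"
    and k: "continuous_on {0..1} k"
  shows "(\<lambda>y. integral {0..1} (\<lambda>t. f (vector [u * unit_circle t, y]) * k t)) holomorphic_on UNIV"
proof -
  obtain a where a: "\<And>z. z \<in> S \<Longrightarrow> (f has_derivative cform (a z)) (at z)"
    using f by (metis holo_fun_onD)
  have ca: "continuous_on S a" by (rule partial_holo(1)[OF a S])
  have "(\<lambda>y. integral (cbox 0 1) (\<lambda>t. f (vector [u * unit_circle t, y]) * k t)) holomorphic_on UNIV"
  proof (rule leibniz_rule_holomorphic)
    fix y and t :: real
    have "((\<lambda>w. f (axis 1 (u * unit_circle t) + axis 2 w)) has_field_derivative a (vector [u * unit_circle t, y]) $ 2) (at y)"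
      unfolding vector_eq_axis by (rule cform_line, rule a, fold vector_eq_axis, rule sub)
    then show "((\<lambda>y. f (vector [u * unit_circle t, y]) * k t) has_field_derivative
        a (vector [u * unit_circle t, y]) $ 2 * k t) (at y within UNIV)"
      unfolding vector_eq_axis by (rule DERIV_cmult_right)
  next
    fix y
    show "(\<lambda>t. f (vector [u * unit_circle t, y]) * k t) integrable_on cbox 0 1"
      by (intro integrable_continuous continuous_on_mult continuous_on_compose2[OF holo_fun_on_imp_continuous_on[OF f]]
            continuous_on_vector2 continuous_intros)
         (use sub k in auto)
  next
    show "continuous_on (UNIV \<times> cbox 0 1) (\<lambda>(y, t). a (vector [u * unit_circle t, y]) $ 2 * k t)"
      unfolding split_beta
      by (intro continuous_on_mult continuous_on_component continuous_on_compose2[OF ca] continuous_on_compose2[OF k]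
            continuous_on_vector2 continuous_intros)
         (use sub in auto)
  qed auto
  then show ?thesis by simp
qed

lemma Cauchy_integral_unit_circle:
  assumes g: "g holomorphic_on cball 0 1" and x: "cmod x < 1"
  shows "integral {0..1} (\<lambda>t. g (unit_circle t) * (unit_circle t / (unit_circle t - x))) = g x"
proof -
  have "((\<lambda>u. g u / (u - x)) has_contour_integral (2 * of_real pi * \<i> * g x)) (circlepath 0 1)"
    by (rule Cauchy_integral_circlepath)
       (use g x in \<open>auto intro: holomorphic_on_imp_continuous_on holomorphic_on_subset\<close>)
  from contour_integral_unique[OF this]
  show ?thesis by (simp add: contour_integral_circlepath_unit_circle)
qed

text \<open>Up to the factor \<open>2 pi i\<close> both sides are contour integrals of
  \<open>g w / w\<close>, and radial segments through the annulus give a homotopy between the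
  circles.\<close>

lemma integral_circle_radius:
  assumes g: "g holomorphic_on S" and S: "open S" and sub: "\<And>w. 1 \<le> cmod w \<Longrightarrow> cmod w \<le> R \<Longrightarrow> w \<in> S" and R: "1 \<le> R"
  shows "integral {0..1} (\<lambda>t. g (unit_circle t)) = integral {0..1} (\<lambda>t. g (of_real R * unit_circle t))"
proof -
  have "contour_integral (circlepath 0 1) (\<lambda>w. g w / w) = contour_integral (circlepath 0 R) (\<lambda>w. g w / w)"
  proof (rule Cauchy_theorem_homotopic_loops)
    show "homotopic_loops (S - {0}) (circlepath 0 1) (circlepath 0 R)"
    proof (rule homotopic_loops_linear)
      fix t :: real assume "t \<in> {0..1}"
      show "closed_segment (circlepath 0 1 t) (circlepath 0 R t) \<subseteq> S - {0}"
      proof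
        fix w assume "w \<in> closed_segment (circlepath 0 1 t) (circlepath 0 R t)"
        then obtain s where s: "0 \<le> s" "s \<le> 1" "w = of_real ((1 - s) + s * R) * unit_circle t"
          by (auto simp: closed_segment_def circlepath unit_circle_def scaleR_conv_of_real algebra_simps)
        have "1 \<le> (1 - s) + s * R" "(1 - s) + s * R \<le> R"
          using s R mult_left_mono[of 1 R s] mult_left_mono[of 1 R "1 - s"] by (auto simp: algebra_simps)
        moreover from this have "cmod w = (1 - s) + s * R"
          unfolding s(3) norm_mult norm_unit_circle norm_of_real by simp
        ultimately show "w \<in> S - {0}" using sub[of w] by auto
      qed
    qed auto
  qed (use S g in \<open>auto intro!: holomorphic_intros intro: holomorphic_on_subset\<close>)
  then show ?thesis
    using R by (simp add: contour_integral_circlepath_unit_circle)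
qed

text \<open>The coordinates of \<open>f3\<close> stand for \<open>x/z\<close> and
  \<open>y/z\<close>, those of \<open>f2\<close> for \<open>x/y\<close> and \<open>z/y\<close>. The
  right side contains neither \<open>x0\<close> nor \<open>y0\<close>, so \<open>f3\<close> is
  constant on the bidisc.\<close>

lemma circle_integral_constant:
  fixes f3 f2 :: "complex^2 \<Rightarrow> complex"
  assumes f3: "holo_fun_on S3 f3" "open S3" and f2: "holo_fun_on S2 f2"
    and S3: "\<And>x y. cmod y < 1 \<Longrightarrow> vector [x, y] \<in> S3"
      "\<And>x y. 1 < cmod x \<Longrightarrow> cmod x < 5 / 4 \<Longrightarrow> vector [x, y] \<in> S3"
      "\<And>x y. x \<noteq> 0 \<Longrightarrow> 2 < cmod y \<Longrightarrow> vector [x, y] \<in> S3"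
    and S2: "\<And>x y. x \<noteq> 0 \<Longrightarrow> cmod y < 1 / 2 \<Longrightarrow> vector [x, y] \<in> S2"
    and f32: "\<And>x y. y \<noteq> 0 \<Longrightarrow> f3 (vector [x, y]) = f2 (vector [x / y, 1 / y])"
    and x0: "cmod x0 < 1" and y0: "cmod y0 < 1"
  shows "f3 (vector [x0, y0]) = integral {0..1} (\<lambda>t. f2 (vector [9 / 8 * unit_circle t, 0]))"
proof -
  \<comment> \<open>The radius \<open>9 / 8\<close> of the circles to be used lies between 1 and
    \<open>5 / 4\<close>. The parameter \<open>u\<close> is complex because its phase is later
    matched to that of \<open>y\<close>.\<close>
  define F where "F u y = integral {0..1} (\<lambda>t. f3 (vector [u * unit_circle t, y]) *
     (u * unit_circle t / (u * unit_circle t - x0)))" for u y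
  \<comment> \<open>The inflated integral as seen in the second chart, with \<open>\<zeta>\<close>
    standing for \<open>1 / y\<close>.\<close>
  define \<Phi> where "\<Phi> \<zeta> = integral {0..1} (\<lambda>t. f2 (vector [9 / 8 * unit_circle t, \<zeta>]) *
     (9 / 8 * unit_circle t / (9 / 8 * unit_circle t - x0 * \<zeta>)))" for \<zeta>
  have ne: "u * unit_circle t \<noteq> x" if "cmod u = 9 / 8" "cmod x < 1" for u t x
    using that norm_mult[of u "unit_circle t"] by auto
  have scaled: "(\<lambda>w. f3 (vector [u * w, y])) holomorphic_on T"
    if "\<And>w. w \<in> T \<Longrightarrow> vector [u * w, y] \<in> S3" for u y T
  proof -
    have "(\<lambda>x. f3 (vector [x, y])) holomorphic_on ((\<lambda>w. u * w) ` T)"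
      by (rule holo_fun_on_slice(1)[OF f3(1)]) (use that in auto)
    moreover have "(\<lambda>w. u * w) holomorphic_on T" by (intro holomorphic_intros)
    ultimately show ?thesis
      using holomorphic_on_compose by (fastforce simp: o_def)
  qed
  have entire: "F u holomorphic_on UNIV" if "cmod u = 9 / 8" for u
    unfolding F_def[abs_def]
    by (rule integral_holo_slices[OF f3])
       (use that ne[OF that x0] in \<open>auto intro!: S3(2) continuous_intros simp: norm_mult\<close>)
  have F_disc: "F u y = f3 (vector [x0, y])" if u: "cmod u = 9 / 8" and y: "cmod y < 1" for u y
  proof -
    have u0: "u \<noteq> 0" using u by auto
    have "(\<lambda>w. f3 (vector [u * w, y])) holomorphic_on cball 0 1"
      by (rule scaled, rule S3(1)[OF y])
    from Cauchy_integral_unit_circle[OF this, of "x0 / u"]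
    have "integral {0..1} (\<lambda>t. f3 (vector [u * unit_circle t, y]) * (unit_circle t / (unit_circle t - x0 / u))) = f3 (vector [x0, y])"
      using x0 u u0 by (simp add: norm_divide)
    moreover have "unit_circle t / (unit_circle t - x0 / u) = u * unit_circle t / (u * unit_circle t - x0)" for t
      using u0 ne[OF u x0, of t] by (simp add: field_simps)
    ultimately show ?thesis by (simp add: F_def)
  qed
  \<comment> \<open>Both entire functions agree with \<open>f3 (vector [x0, y])\<close> on the unit
    disc, hence everywhere.\<close>
  have F_rot: "F u y = F (9 / 8) y" if u: "cmod u = 9 / 8" for u y
    by (rule analytic_continuation_open[of "ball 0 1" UNIV])
       (use entire[OF u] entire[of "9 / 8"] F_disc[OF u] F_disc[of "9 / 8"] in auto)
  have F_inf: "F (9 / 8) y = \<Phi> (1 / y)" if y: "2 < cmod y" for y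
  proof -
    define R where "R = cmod y"
    \<comment> \<open>With the phase of \<open>y\<close> in \<open>u\<close>, inflating the circle
      by \<open>R\<close> gives the points \<open>9 / 8 * unit_circle t * y\<close>. The chart
      change divides them by \<open>y\<close>, so the circle no longer depends on
      \<open>y\<close>.\<close>
    define u where "u = 9 / 8 * (y / of_real R)"
    have R: "R > 2" "y \<noteq> 0" using y by (auto simp: R_def)
    have u: "cmod u = 9 / 8" using R by (simp add: u_def norm_mult norm_divide R_def)
    have u0: "u \<noteq> 0" using u by auto
    define g where "g w = f3 (vector [u * w, y]) * (u * w / (u * w - x0))" for w
    \<comment> \<open>Here \<open>u * w\<close> has modulus above 1, hence above that of
      \<open>x0\<close>, so the kernel has no pole and the circle can grow from radius 1 to
      \<open>R\<close>.\<close>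
    have "g holomorphic_on {w. 8 / 9 < cmod w}"
    proof -
      have "(\<lambda>w. f3 (vector [u * w, y])) holomorphic_on {w. 8 / 9 < cmod w}"
        by (rule scaled, rule S3(3)[OF _ y]) (use u0 in auto)
      moreover have "u * w \<noteq> x0" if "8 / 9 < cmod w" for w
        using that x0 norm_mult[of u w] u by auto
      ultimately show ?thesis
        unfolding g_def[abs_def] by (intro holomorphic_intros) auto
    qed
    moreover have "open {w. 8 / 9 < cmod w}" by (intro open_Collect_less continuous_intros)
    ultimately have radius: "integral {0..1} (\<lambda>t. g (unit_circle t)) = integral {0..1} (\<lambda>t. g (of_real R * unit_circle t))"
      using R by (intro integral_circle_radius) auto
    have rescale: "g (of_real R * unit_circle t) = f2 (vector [9 / 8 * unit_circle t, 1 / y]) *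
        (9 / 8 * unit_circle t / (9 / 8 * unit_circle t - x0 * (1 / y)))" for t
    proof -
      have 1: "u * (of_real R * unit_circle t) = 9 / 8 * unit_circle t * y" using R by (simp add: u_def)
      have "9 / 8 * unit_circle t * y / (9 / 8 * unit_circle t * y - x0) = 9 / 8 * unit_circle t / (9 / 8 * unit_circle t - x0 * (1 / y))"
      proof -
        have "9 / 8 * unit_circle t * y - x0 = (9 / 8 * unit_circle t - x0 * (1 / y)) * y"
          using R by (simp add: left_diff_distrib)
        then show ?thesis using R by simp
      qed
      moreover have "f3 (vector [9 / 8 * unit_circle t * y, y]) = f2 (vector [9 / 8 * unit_circle t, 1 / y])"
        using f32[of y "9 / 8 * unit_circle t * y"] R by simp
      ultimately show ?thesis unfolding g_def 1 by simp
    qed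
    have "F u y = integral {0..1} (\<lambda>t. g (unit_circle t))" by (simp add: F_def g_def)
    also note radius
    also have "integral {0..1} (\<lambda>t. g (of_real R * unit_circle t)) = \<Phi> (1 / y)"
      by (simp only: rescale \<Phi>_def)
    finally have "F u y = \<Phi> (1 / y)" .
    then show ?thesis using F_rot[OF u] by simp
  qed
  have "continuous_on (ball 0 (1 / 2)) (\<lambda>\<zeta>. integral (cbox 0 1) (\<lambda>t. f2 (vector [9 / 8 * unit_circle t, \<zeta>]) *
     (9 / 8 * unit_circle t / (9 / 8 * unit_circle t - x0 * \<zeta>))))"
  proof (rule integral_continuous_on_param)
    have "9 / 8 * unit_circle t \<noteq> x0 * \<zeta>" if "cmod \<zeta> < 1 / 2" for t \<zeta>
      using ne[of "9 / 8" "x0 * \<zeta>"] that x0 mult_strict_mono[of "cmod x0" 1 "cmod \<zeta>" 1] by (auto simp: norm_mult)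
    then show "continuous_on (ball 0 (1 / 2) \<times> cbox 0 1) (\<lambda>(\<zeta>, t). f2 (vector [9 / 8 * unit_circle t, \<zeta>]) *
        (9 / 8 * unit_circle t / (9 / 8 * unit_circle t - x0 * \<zeta>)))"
      unfolding split_beta
      by (intro continuous_on_mult continuous_on_divide continuous_on_compose2[OF holo_fun_on_imp_continuous_on[OF f2]]
            continuous_on_vector2 continuous_intros)
         (auto intro!: S2)
  qed
  then have "continuous_on (ball 0 (1 / 2)) \<Phi>" by (simp add: \<Phi>_def[abs_def])
  then have "(\<Phi> \<longlongrightarrow> \<Phi> 0) (at 0)"
    by (simp add: continuous_on_eq_continuous_at isCont_def)
  then have "((\<lambda>y. \<Phi> (inverse y)) \<longlongrightarrow> \<Phi> 0) at_infinity"
    using lim_at_infinity_0[of "\<Phi>" "\<Phi> 0"] by (simp add: o_def lim_at_infinity_0)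
  moreover have "\<forall>\<^sub>F y in at_infinity. \<Phi> (inverse y) = F (9 / 8) y"
    using F_inf unfolding eventually_at_infinity by (intro exI[of _ 3]) (simp add: inverse_eq_divide)
  ultimately have "(F (9 / 8) \<longlongrightarrow> \<Phi> 0) at_infinity"
    by (rule Lim_transform_eventually)
  \<comment> \<open>An entire function with a finite limit at infinity equals that limit
    everywhere.\<close>
  then have "F (9 / 8) y0 = \<Phi> 0"
    by (intro Liouville_weak entire) simp_all
  \<comment> \<open>At \<open>\<zeta> = 0\<close> the kernel is 1, so \<open>x0\<close>
    disappears.\<close>
  moreover have "\<Phi> 0 = integral {0..1} (\<lambda>t. f2 (vector [9 / 8 * unit_circle t, 0]))"
    by (simp add: \<Phi>_def)
  ultimately show ?thesis using F_disc[OF _ y0, of "9 / 8"] by simp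
qed

text \<open>The constant spreads by analytic continuation in one variable at a time: from the bidisc
  in \<open>x\<close>, over the annulus in \<open>y\<close>, then in the second chart from an
  annulus in \<open>x\<close>, and at last in \<open>y\<close> across \<open>y = 0\<close>.\<close>

lemma holo_constant_across_chart:
  fixes f3 f2 :: "complex^2 \<Rightarrow> complex"
  assumes f3: "holo_fun_on S3 f3" "open S3" and f2: "holo_fun_on S2 f2"
    and S3: "\<And>x y. cmod y < 1 \<Longrightarrow> vector [x, y] \<in> S3"
      "\<And>x y. 1 < cmod x \<Longrightarrow> cmod x < 5 / 4 \<Longrightarrow> vector [x, y] \<in> S3"
      "\<And>x y. x \<noteq> 0 \<Longrightarrow> 2 < cmod y \<Longrightarrow> vector [x, y] \<in> S3"
    and S2: "\<And>x y. x \<noteq> 0 \<Longrightarrow> cmod y < 1 / 2 \<Longrightarrow> vector [x, y] \<in> S2"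
    and f32: "\<And>x y. y \<noteq> 0 \<Longrightarrow> f3 (vector [x, y]) = f2 (vector [x / y, 1 / y])"
  obtains c where "\<And>x y. cmod y < 1 \<Longrightarrow> f3 (vector [x, y]) = c"
    "\<And>x y. 1 < cmod x \<Longrightarrow> cmod x < 5 / 4 \<Longrightarrow> f3 (vector [x, y]) = c"
    "\<And>x y. x \<noteq> 0 \<Longrightarrow> cmod y < 1 / 2 \<Longrightarrow> f2 (vector [x, y]) = c"
proof -
  obtain c where c: "f3 (vector [x, y]) = c" if "cmod x < 1" "cmod y < 1" for x y
    using circle_integral_constant[OF f3 f2 S3 S2 f32] by blast
  have 1: "f3 (vector [x, y]) = c" if y: "cmod y < 1" for x y
    by (rule analytic_continuation_open[of "ball 0 1" UNIV "\<lambda>x. f3 (vector [x, y])" "\<lambda>_. c"])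
       (use c[OF _ y] holo_fun_on_slice(1)[OF f3(1) S3(1)[OF y]] in auto)
  have 2: "f3 (vector [x, y]) = c" if x: "1 < cmod x" "cmod x < 5 / 4" for x y
    by (rule analytic_continuation_open[of "ball 0 1" UNIV "\<lambda>y. f3 (vector [x, y])" "\<lambda>_. c"])
       (use 1 holo_fun_on_slice(2)[OF f3(1) S3(2)[OF x]] in auto)
  have 3: "f2 (vector [x, y]) = c" if y: "y \<noteq> 0" "cmod y < 1 / 2" and x: "x \<noteq> 0" for x y
  \<comment> \<open>This annulus is the one between 1 and \<open>5 / 4\<close> moved to the second
    chart, where the old first coordinate becomes the quotient \<open>x / y\<close>.\<close>
  proof (rule analytic_continuation_open[of "{x. cmod y < cmod x \<and> cmod x < 5 / 4 * cmod y}" "- {0}" "\<lambda>x. f2 (vector [x, y])" "\<lambda>_. c"])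
    show "(\<lambda>x. f2 (vector [x, y])) holomorphic_on - {0}"
      by (rule holo_fun_on_slice(1)[OF f2 S2]) (use y in auto)
    show "open {x. cmod y < cmod x \<and> cmod x < 5 / 4 * cmod y}"
      by (intro open_Collect_conj open_Collect_less continuous_intros)
    have "9 / 8 * y \<in> {x. cmod y < cmod x \<and> cmod x < 5 / 4 * cmod y}" using y by (simp add: norm_mult)
    then show "{x. cmod y < cmod x \<and> cmod x < 5 / 4 * cmod y} \<noteq> {}" by blast
    fix x assume "x \<in> {x. cmod y < cmod x \<and> cmod x < 5 / 4 * cmod y}"
    then have "f3 (vector [x / y, 1 / y]) = c" using y by (intro 2) (auto simp: norm_divide field_simps)
    then show "f2 (vector [x, y]) = c" using f32[of "1 / y" "x / y"] y by simp
  qed (use x in \<open>auto intro: connected_punctured_universe\<close>)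
  have "1 / 4 \<in> ball 0 (1 / 2) - {0 :: complex}" by simp
  then have ne: "ball 0 (1 / 2) - {0 :: complex} \<noteq> {}" by blast
  \<comment> \<open>The remaining points \<open>y = 0\<close> are those with \<open>z = 0\<close>,
    which the third chart does not contain.\<close>
  have 4: "f2 (vector [x, y]) = c" if "cmod y < 1 / 2" and x: "x \<noteq> 0" for x y
    by (rule analytic_continuation_open[of "ball 0 (1/2) - {0}" "ball 0 (1/2)" "\<lambda>y. f2 (vector [x, y])" "\<lambda>_. c"])
       (use that 3 ne holo_fun_on_slice(2)[OF f2 S2[OF x], of "ball 0 (1/2)"] in auto)
  from that[OF 1 2 4] show ?thesis .
qed

section \<open>The pieces in affine coordinates, constancy and connectedness\<close>

lemma thin_domain_chart3:
  "affine_param 3 w \<in> inner_piece \<longleftrightarrow> cmod (w $ 2) < 1"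
  "affine_param 3 w \<in> bridge \<longleftrightarrow> 1 < cmod (w $ 1) \<and> cmod (w $ 1) < 5 / 4 \<and> cmod (w $ 2) < 11 / 5"
  "affine_param 3 w \<in> outer_piece \<longleftrightarrow> w $ 1 \<noteq> 0 \<and> 2 < cmod (w $ 2)"
  by (auto simp: affine_param_simps cp2_point_mem)

lemma thin_domain_chart2:
  "affine_param 2 w \<in> outer_piece \<longleftrightarrow> w $ 1 \<noteq> 0 \<and> cmod (w $ 2) < 1 / 2"
  by (auto simp: affine_param_simps cp2_point_mem)

text \<open>Each piece is a product of planar sets in a suitable chart. For
  \<open>outer_piece\<close> this is the second one, which also contains its points with
  \<open>z = 0\<close>.\<close>

lemma pieces_eq_image:
  "inner_piece = affine_param 3 ` {w. w $ 1 \<in> UNIV \<and> w $ 2 \<in> ball 0 1}"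
  "bridge = affine_param 3 ` {w. w $ 1 \<in> {x. 1 < cmod x \<and> cmod x < 5 / 4} \<and> w $ 2 \<in> ball 0 (11 / 5)}"
  "outer_piece = affine_param 2 ` {w. w $ 1 \<in> - {0} \<and> w $ 2 \<in> ball 0 (1 / 2)}"
proof -
  have "outer_piece \<subseteq> range (affine_param 2)"
    unfolding outer_piece_def by (auto intro!: cp2_point_in_range)
  moreover have "A = affine_param i ` (affine_param i -` A)" if "A \<subseteq> range (affine_param i)" for A i
    using that by (simp add: image_vimage_eq Int_absorb2)
  moreover have "affine_param 3 -` inner_piece = {w. w $ 1 \<in> UNIV \<and> w $ 2 \<in> ball 0 1}"
    "affine_param 3 -` bridge = {w. w $ 1 \<in> {x. 1 < cmod x \<and> cmod x < 5 / 4} \<and> w $ 2 \<in> ball 0 (11 / 5)}"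
    "affine_param 2 -` outer_piece = {w. w $ 1 \<in> - {0} \<and> w $ 2 \<in> ball 0 (1 / 2)}"
    by (auto simp: thin_domain_chart3 thin_domain_chart2)
  ultimately show "inner_piece = affine_param 3 ` {w. w $ 1 \<in> UNIV \<and> w $ 2 \<in> ball 0 1}"
    "bridge = affine_param 3 ` {w. w $ 1 \<in> {x. 1 < cmod x \<and> cmod x < 5 / 4} \<and> w $ 2 \<in> ball 0 (11 / 5)}"
    "outer_piece = affine_param 2 ` {w. w $ 1 \<in> - {0} \<and> w $ 2 \<in> ball 0 (1 / 2)}"
    using pieces_in_charts(1,2) by metis+
qed

lemma holomorphic_thin_domain_constant:
  assumes "cp2_holomorphic_on thin_domain f"
  shows "f constant_on thin_domain"
proof -
  have open_X: "open thin_domain"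
    using open_pieces by (auto simp: thin_domain_def)
  have holo: "holo_fun_on (affine_param i -` thin_domain) (f \<circ> affine_param i)" for i
    using assms by (simp add: cp2_holomorphic_on_def)
  have op: "open (affine_param 3 -` thin_domain)"
    using continuous_on_affine_param[of UNIV 3] open_X by (metis continuous_on_open_vimage open_UNIV Int_UNIV_right)
  have change: "(f \<circ> affine_param 3) (vector [x, y]) = (f \<circ> affine_param 2) (vector [x / y, 1 / y])" if "y \<noteq> 0" for x y
  proof -
    have "affine_param 3 (vector [x, y]) = affine_param 2 (vector [x / y, 1 / y])"
      unfolding affine_param_simps using that
      by (subst cp2_point_eq_iff) (auto simp: vec3_eq_iff intro!: exI[of _ "1 / y"])
    then show ?thesis by simp
  qed
  note const = holo_constant_across_chart[OF holo[of 3] op holo[of 2] _ _ _ _ change]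
  obtain c where c: "\<And>x y. cmod y < 1 \<Longrightarrow> (f \<circ> affine_param 3) (vector [x, y]) = c"
    "\<And>x y. 1 < cmod x \<Longrightarrow> cmod x < 5 / 4 \<Longrightarrow> (f \<circ> affine_param 3) (vector [x, y]) = c"
    "\<And>x y. x \<noteq> 0 \<Longrightarrow> cmod y < 1 / 2 \<Longrightarrow> (f \<circ> affine_param 2) (vector [x, y]) = c"
    \<comment> \<open>Over the annulus the whole \<open>y\<close>-plane lies in
      \<open>thin_domain\<close>: \<open>bridge\<close> and \<open>outer_piece\<close> cover it
      because \<open>2 < 11 / 5\<close>.\<close>
    by (rule const) (auto simp: thin_domain_def thin_domain_chart3 thin_domain_chart2 not_less)
  have "vector [w $ 1, w $ 2] = w" for w :: "complex^2" by (simp add: vec2_eq_iff)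
  then have "f p = c" if "p \<in> thin_domain" for p
    using that c unfolding thin_domain_def pieces_eq_image
    by (auto simp: o_def) metis+
  then show ?thesis unfolding constant_on_def by blast
qed

lemma connected_vec2:
  assumes "connected A" "connected B"
  shows "connected {w :: complex^2. w $ 1 \<in> A \<and> w $ 2 \<in> B}"
proof -
  have "{w :: complex^2. w $ 1 \<in> A \<and> w $ 2 \<in> B} = (\<lambda>(x, y). vector [x, y]) ` (A \<times> B)"
    by (force simp: image_iff vec2_eq_iff)
  moreover have "continuous_on (A \<times> B) (\<lambda>(x, y). vector [x, y] :: complex^2)"
    unfolding split_beta by (intro continuous_on_vector2 continuous_intros)
  ultimately show ?thesis
    using connected_continuous_image[OF _ connected_Times[OF assms]] by simp
qed

lemma connected_thin_domain: "connected thin_domain"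
proof -
  have "connected {x. 1 < cmod x \<and> cmod x < 5 / 4}" "connected (- {0 :: complex})"
    using connected_annulus(1)[of 1 "0 :: complex" "5 / 4"] by (simp_all add: connected_punctured_universe)
  moreover have "connected (affine_param i ` {w. w $ 1 \<in> A \<and> w $ 2 \<in> ball 0 r})" if "connected A" for i A r
    using that by (intro connected_continuous_image continuous_on_affine_param connected_vec2 connected_ball)
  ultimately have "connected inner_piece" "connected bridge" "connected outer_piece"
    using connected_UNIV unfolding pieces_eq_image by blast+
  \<comment> \<open>The witness \<open>9 / 8\<close> lies between 1 and \<open>5 / 4\<close>, and
    \<open>21 / 10\<close> between 2 and \<open>11 / 5\<close>.\<close>
  moreover have "affine_param 3 (vector [9 / 8, 0]) \<in> inner_piece \<inter> bridge"
    "affine_param 3 (vector [9 / 8, 21 / 10]) \<in> (inner_piece \<union> bridge) \<inter> outer_piece"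
    by (auto simp: thin_domain_chart3)
  ultimately show ?thesis
    unfolding thin_domain_def by (intro connected_Un) blast+
qed

theorem theorem1p1:
  "\<exists>X :: cp2 set. open X \<and> connected X \<and> X \<noteq> {} \<and>
     (\<exists>\<rho>. strongly_psh_on X \<rho>) \<and>
     (\<forall>f. cp2_holomorphic_on X f \<longrightarrow> f constant_on X)"
proof (intro exI conjI allI impI)
  show "open thin_domain"
    using open_pieces by (auto simp: thin_domain_def)
  have "affine_param 3 0 \<in> thin_domain"
    by (simp add: thin_domain_def thin_domain_chart3)
  then show "thin_domain \<noteq> {}" by blast
qed (rule connected_thin_domain strongly_psh_on_rho holomorphic_thin_domain_constant, assumption?)+

end
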